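(* Let $U\subset\mathbb{C}^n$ be a connected open subset, let $\mathcal{O}_n(U)$ be the algebra of holomorphic functions on $U$, and let $Z\subset\mathcal{O}_n(U)$ be a finite-dimensional complex vector subspace. Then the set $U_Z^{\mathrm{bdl}}$ of bundle points of all the jet spaces of $Z$ is a non-empty analytically open subset of $U$, and $U_Z^{\mathrm{bdl}}\subset U_Z^{\mathrm{inv}}$, where $U_Z^{\mathrm{inv}}$ is the set of points $b\in U$ at which the least space $Z_b{\downarrow}$ is $D$-invariant.
   Context: Notation: $\mathbb{N}_0=\{0,1,2,\dots\}$; for $\nu\in\mathbb{N}_0^n$, $|\nu|=\nu_1+\dots+\nu_n$ and $\nu!=\nu_1!\cdots\nu_n!$. Jets and bundle points. For $b\in U$, $k\in\mathbb{N}_0$ and $f\in\mathcal{O}_n(U)$ put $j^kf(b)=\bigl(\tfrac{1}{\nu!}\tfrac{\partial^{|\nu|}f}{\partial t^\nu}(b)\bigr)_{|\nu|\le k}$. Put $R_k(b)=\{j^kf(b): f\in Z\}$ (a vector space), $r_k=\max\{\dim_{\mathbb{C}}R_k(t): t\in U\}$ and $U_Z^k=\{t\in U:\dim_{\mathbb{C}}R_k(t)=r_k\}$. The set of bundle points of all the jet spaces of $Z$ is $U_Z^{\mathrm{bdl}}=\bigcap_{k\ge 0}U_Z^k$. A subset of $U$ is called analytically open if it is the complement in $U$ of a closed analytic subset of $U$. Least spaces. Let $\tau=(\tau_1,\dots,\tau_n)$ be variables. For a nonzero germ $f=\sum_\nu c_\nu(t-b)^\nu$ of holomorphic function at $b$,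 with $k$ the smallest $|\nu|$ such that $c_\nu\ne0$, its least part is $f_b{\downarrow}=\sum_{|\nu|=k}c_\nu\tau^\nu\in\mathbb{C}[\tau]$; also $0_b{\downarrow}=0$. The least space of $Z$ at $b$ is $Z_b{\downarrow}=\mathrm{Span}_{\mathbb{C}}\{f_b{\downarrow}: f\in Z\}\subset\mathbb{C}[\tau]$. A vector subspace of $\mathbb{C}[\tau]$ is $D$-invariant if it is closed under all partial differentiations $\partial/\partial\tau_1,\dots,\partial/\partial\tau_n$. *)

theory Defs
  imports
    "HOL-Complex_Analysis.Complex_Analysis"
    "HOL-Library.Function_Algebras"
    "HOL-Library.Poly_Mapping"
begin

section \<open>Complex vector spaces of functions\<close>

text \<open>The type class of real vector spaces has no complex counterpart in the library, so complex
  subspaces, spans and dimensions come from the locale of vector spaces over a field. The additive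
  structure on functions is the pointwise one.\<close>

definition fscale :: "complex \<Rightarrow> ('a \<Rightarrow> complex) \<Rightarrow> 'a \<Rightarrow> complex" where
  "fscale c f = (\<lambda>x. c * f x)"

global_interpretation cfun: vector_space "fscale :: complex \<Rightarrow> ('a \<Rightarrow> complex) \<Rightarrow> 'a \<Rightarrow> complex"
  by unfold_locales (auto simp: fscale_def fun_eq_iff algebra_simps)

section \<open>Holomorphic functions of several variables\<close>

text \<open>For open \<open>V\<close>: complex (Frechet) differentiability at every point of \<open>V\<close>, that is, the real
  total derivative exists and is complex linear.\<close>

definition holo_on :: "(complex^'n \<Rightarrow> complex) \<Rightarrow> (complex^'n) set \<Rightarrow> bool" where
  "holo_on f V \<longleftrightarrow>
     (\<forall>z\<in>V. \<exists>f'. (f has_derivative f') (at z) \<and> (\<forall>c v. f' (c *s v) = c * f' v))"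

text \<open>HOL functions are total. A function on \<open>U\<close> is represented by its extension by zero, so that
  this set is in bijection with the algebra of holomorphic functions on \<open>U\<close>.\<close>

definition holo_fns :: "(complex^'n) set \<Rightarrow> (complex^'n \<Rightarrow> complex) set" where
  "holo_fns U = {f. holo_on f U \<and> (\<forall>z. z \<notin> U \<longrightarrow> f z = 0)}"

definition closed_analytic_subset :: "(complex^'n) set \<Rightarrow> (complex^'n) set \<Rightarrow> bool" where
  "closed_analytic_subset U A \<longleftrightarrow> A \<subseteq> U \<and>
     (\<forall>a\<in>U. \<exists>V G. open V \<and> a \<in> V \<and> V \<subseteq> U \<and> finite G \<and> (\<forall>g\<in>G. holo_on g V) \<and>
        A \<inter> V = {z\<in>V. \<forall>g\<in>G. g z = 0})"

definition analytically_open :: "(complex^'n) set \<Rightarrow> (complex^'n) set \<Rightarrow> bool" where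
  "analytically_open U W \<longleftrightarrow> (\<exists>A. closed_analytic_subset U A \<and> W = U - A)"

section \<open>Multi-indices and Taylor coefficients\<close>

definition mi_size :: "nat^'n \<Rightarrow> nat" where
  "mi_size \<nu> = (\<Sum>i\<in>UNIV. \<nu> $ i)"

definition mi_fact :: "nat^'n \<Rightarrow> nat" where
  "mi_fact \<nu> = (\<Prod>i\<in>UNIV. fact (\<nu> $ i))"

definition cpartial :: "'n \<Rightarrow> (complex^'n \<Rightarrow> complex) \<Rightarrow> complex^'n \<Rightarrow> complex" where
  "cpartial i f b = deriv (\<lambda>s. f (b + s *s axis i 1)) 0"

text \<open>The iterated partial derivatives are taken in some fixed order of the coordinates; for
  holomorphic functions the partial derivatives commute and the order is immaterial.\<close>

definition coord_list :: "'n::finite list" where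
  "coord_list = (SOME xs. distinct xs \<and> set xs = UNIV)"

definition mpartial :: "nat^'n \<Rightarrow> (complex^'n \<Rightarrow> complex) \<Rightarrow> complex^'n \<Rightarrow> complex" where
  "mpartial \<nu> f = foldr (\<lambda>i. cpartial i ^^ (\<nu> $ i)) coord_list f"

definition taylor_coeff :: "(complex^'n \<Rightarrow> complex) \<Rightarrow> complex^'n \<Rightarrow> nat^'n \<Rightarrow> complex" where
  "taylor_coeff f b \<nu> = mpartial \<nu> f b / of_nat (mi_fact \<nu>)"

section \<open>Jet spaces and bundle points\<close>

text \<open>A tuple indexed by the multi-indices of size at most \<open>k\<close> is represented by the function that
  vanishes at all other multi-indices.\<close>

definition jet :: "nat \<Rightarrow> (complex^'n \<Rightarrow> complex) \<Rightarrow> complex^'n \<Rightarrow> nat^'n \<Rightarrow> complex" where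
  "jet k f b = (\<lambda>\<nu>. if mi_size \<nu> \<le> k then taylor_coeff f b \<nu> else 0)"

definition jet_space ::
    "(complex^'n \<Rightarrow> complex) set \<Rightarrow> nat \<Rightarrow> complex^'n \<Rightarrow> (nat^'n \<Rightarrow> complex) set" where
  "jet_space Z k b = (\<lambda>f. jet k f b) ` Z"

definition jet_rank :: "(complex^'n) set \<Rightarrow> (complex^'n \<Rightarrow> complex) set \<Rightarrow> nat \<Rightarrow> nat" where
  "jet_rank U Z k = Max ((\<lambda>t. cfun.dim (jet_space Z k t)) ` U)"

definition bundle_points_at ::
    "(complex^'n) set \<Rightarrow> (complex^'n \<Rightarrow> complex) set \<Rightarrow> nat \<Rightarrow> (complex^'n) set" where
  "bundle_points_at U Z k = {t\<in>U. cfun.dim (jet_space Z k t) = jet_rank U Z k}"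

definition bundle_points ::
    "(complex^'n) set \<Rightarrow> (complex^'n \<Rightarrow> complex) set \<Rightarrow> (complex^'n) set" where
  "bundle_points U Z = (\<Inter>k. bundle_points_at U Z k)"

section \<open>Polynomials and least spaces\<close>

text \<open>The polynomial ring in variables indexed by \<open>'n\<close> is the monoid algebra of the multi-indices:
  a polynomial is the finitely supported family of its coefficients, and the monomial with exponent
  \<open>\<nu>\<close> and coefficient \<open>c\<close> is \<open>Poly_Mapping.single \<nu> c\<close>.\<close>

type_synonym 'n cpoly = "(nat^'n) \<Rightarrow>\<^sub>0 complex"

definition pscale :: "complex \<Rightarrow> 'n cpoly \<Rightarrow> 'n::finite cpoly" where
  "pscale c p = Poly_Mapping.map ((*) c) p"

lemma lookup_pscale: "Poly_Mapping.lookup (pscale c p) \<nu> = c * Poly_Mapping.lookup p \<nu>"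
  by (simp add: pscale_def Poly_Mapping.map.rep_eq when_def)

global_interpretation cpoly: vector_space "pscale :: complex \<Rightarrow> 'n cpoly \<Rightarrow> 'n::finite cpoly"
  by unfold_locales
    (auto simp: lookup_pscale lookup_add algebra_simps intro!: poly_mapping_eqI)

text \<open>Termwise: the monomial with exponent \<open>\<nu>\<close> is sent to \<open>\<nu> $ i\<close> times the monomial with exponent
  \<open>\<nu> - axis i 1\<close>. Truncated subtraction only occurs when that factor is zero.\<close>

definition pderiv_at :: "'n \<Rightarrow> 'n cpoly \<Rightarrow> 'n::finite cpoly" where
  "pderiv_at i p = (\<Sum>\<nu>\<in>Poly_Mapping.keys p.
     Poly_Mapping.single (\<nu> - axis i 1) (of_nat (\<nu> $ i) * Poly_Mapping.lookup p \<nu>))"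

definition D_invariant :: "'n::finite cpoly set \<Rightarrow> bool" where
  "D_invariant P \<longleftrightarrow> cpoly.subspace P \<and> (\<forall>i. \<forall>p\<in>P. pderiv_at i p \<in> P)"

text \<open>The germ of a holomorphic function at \<open>b\<close> is zero iff the function vanishes near \<open>b\<close>, and the
  coefficients of its power series expansion at \<open>b\<close> are the Taylor coefficients.\<close>

definition least_part :: "complex^'n \<Rightarrow> (complex^'n \<Rightarrow> complex) \<Rightarrow> 'n::finite cpoly" where
  "least_part b f =
     (if eventually (\<lambda>t. f t = 0) (nhds b) then 0
      else let k = (LEAST m. \<exists>\<nu>. mi_size \<nu> = m \<and> taylor_coeff f b \<nu> \<noteq> 0)
           in \<Sum>\<nu> | mi_size \<nu> = k. Poly_Mapping.single \<nu> (taylor_coeff f b \<nu>))"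

definition least_space ::
    "(complex^'n \<Rightarrow> complex) set \<Rightarrow> complex^'n \<Rightarrow> 'n::finite cpoly set" where
  "least_space Z b = cpoly.span (least_part b ` Z)"

definition inv_points ::
    "(complex^'n) set \<Rightarrow> (complex^'n \<Rightarrow> complex) set \<Rightarrow> (complex^'n::finite) set" where
  "inv_points U Z = {b\<in>U. D_invariant (least_space Z b)}"

end

theory Submission
  imports Defs
begin

text \<open>Linear independence of \<open>r\<close> jets at \<open>t\<close> is the non-vanishing of one of finitely many functions
  obtained from their coefficients by Gaussian elimination without division. Hence each
  \<open>U_Z^k\<close> is the complement of an analytic set. The ranks \<open>r_k\<close> increase and are bounded, so only
  finitely many \<open>k\<close> matter, and the identity theorem shows that finitely many non-empty sets of this
  kind have a common point.

  For the invariance, let \<open>f\<close> vanish to order \<open>k\<close> at a bundle point \<open>b\<close>. Since the rank of the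
  \<open>(k-1)\<close>-jets is constant near \<open>b\<close> and the \<open>(k-1)\<close>-jet of \<open>f\<close> is zero at \<open>b\<close>, the derivative of that
  jet in a coordinate direction is again the jet at \<open>b\<close> of some \<open>g\<close> in \<open>Z\<close>. The homogeneous part of
  degree \<open>k-1\<close> of \<open>g\<close> is the derivative of the least part of \<open>f\<close>.\<close>

section \<open>Partial derivatives of holomorphic functions\<close>

(* Both power series and vectors use the infix $. *)
unbundle no fps_syntax

section \<open>Complex lines and the complex differential\<close>

lemma norm_vscale: "norm (s *s (v :: complex^'n)) = norm s * norm v"
  by (simp add: norm_vec_def L2_set_def norm_mult power_mult_distrib flip: sum_distrib_left)
     (simp add: real_sqrt_mult)

lemma norm_caxis: "norm (axis i (1::complex) :: complex^'n) = 1"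
proof -
  have "(norm (axis i (1::complex) $ j))\<^sup>2 = (if j = i then 1 else 0)" for j :: 'n
    by (simp add: axis_def)
  then show ?thesis by (simp add: norm_vec_def L2_set_def)
qed

lemma axis_scale_norm: "norm (s *s axis i (1::complex) :: complex^'n) = norm s"
  by (simp add: norm_vscale norm_caxis)

lemma vec_sum_axis: "(h :: complex^'n) = (\<Sum>j\<in>UNIV. (h$j) *s axis j 1)"
  by (simp add: vec_eq_iff axis_def if_distrib cong: if_cong)

lemma bounded_linear_vscale: "bounded_linear (\<lambda>s::complex. s *s (v::complex^'n))"
  by (intro bounded_linear_intro [where K="norm v"])
     (auto simp: vec_eq_iff algebra_simps norm_vscale)

lemma has_derivative_vscale [derivative_intros]:
  "((\<lambda>s::complex. a + s *s (v::complex^'n)) has_derivative (\<lambda>s. s *s v)) F"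
  using bounded_linear.has_derivative[OF bounded_linear_vscale[of v] has_derivative_ident, of F]
  by (auto intro!: derivative_eq_intros)

lemma continuous_on_vscale [continuous_intros]:
  "continuous_on S (\<lambda>s::complex. a + s *s (v::complex^'n))"
  by (rule has_derivative_continuous_on) (rule has_derivative_vscale)

text \<open>Complex linearity turns the real derivative along a complex line into multiplication by
  the number \<open>f' v\<close>. This is how one-variable complex analysis enters.\<close>

lemma holo_line_derivative:
  fixes b v :: "complex^'n"
  assumes "(f has_derivative f') (at (b + s *s v))" "\<And>c v. f' (c *s v) = c * f' v"
  shows "((\<lambda>s. f (b + s *s v)) has_field_derivative f' v) (at s)"
proof -
  have "((\<lambda>s. f (b + s *s v)) has_derivative (\<lambda>x. f' (x *s v))) (at s)"
    using has_derivative_compose[OF has_derivative_vscale[of b v "at s"] assms(1)] .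
  moreover have "(\<lambda>x. f' (x *s v)) = (*) (f' v)" by (auto simp: assms(2))
  ultimately show ?thesis by (simp add: has_field_derivative_def)
qed

lemma cpartial_eq:
  assumes "(f has_derivative f') (at b)" "\<And>c v. f' (c *s v) = c * f' v"
  shows "cpartial i f b = f' (axis i 1)"
  unfolding cpartial_def
  by (rule DERIV_imp_deriv, rule holo_line_derivative) (use assms in auto)

text \<open>Built from the partial derivatives so as to be complex linear in \<open>h\<close> for
  every \<open>f\<close>; it is the canonical witness for the existential in
  \<open>holo_on\<close>.\<close>

definition cgrad :: "(complex^'n \<Rightarrow> complex) \<Rightarrow> complex^'n \<Rightarrow> complex^'n \<Rightarrow> complex" where
  "cgrad f z h = (\<Sum>j\<in>UNIV. h$j * cpartial j f z)"

lemma cgrad_scale: "cgrad f z (c *s h) = c * cgrad f z h"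
  by (simp add: cgrad_def sum_distrib_left mult.assoc)

lemma cgrad_axis: "cgrad f z (axis i 1) = cpartial i f z"
  by (simp add: cgrad_def axis_def if_distrib if_distribR cong: if_cong)

text \<open>A complex linear derivative is determined by its values on the coordinate vectors, and
  these are the partial derivatives.\<close>

lemma holo_on_iff:
  "holo_on f V \<longleftrightarrow> (\<forall>z\<in>V. (f has_derivative cgrad f z) (at z))"
proof -
  have "f' = cgrad f z" if "(f has_derivative f') (at z)" "\<forall>c v. f' (c *s v) = c * f' v" for f' z
  proof
    fix h
    interpret f': bounded_linear f' using that(1) by (rule has_derivative_bounded_linear)
    have "f' h = f' (\<Sum>j\<in>UNIV. (h$j) *s axis j 1)" using vec_sum_axis[of h] by simp
    also have "\<dots> = cgrad f z h" using that
      by (simp add: f'.sum cgrad_def cpartial_eq[OF that(1)])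
    finally show "f' h = cgrad f z h" .
  qed
  then show ?thesis unfolding holo_on_def by (metis cgrad_scale)
qed

lemma holo_onD: "holo_on f V \<Longrightarrow> z \<in> V \<Longrightarrow> (f has_derivative cgrad f z) (at z)"
  by (simp add: holo_on_iff)

lemma holo_on_subset: "holo_on f V \<Longrightarrow> W \<subseteq> V \<Longrightarrow> holo_on f W"
  by (auto simp: holo_on_def)

lemma holo_on_imp_continuous_on: "holo_on f V \<Longrightarrow> continuous_on V f"
  by (meson holo_onD has_derivative_at_withinI has_derivative_continuous_on)

lemma holo_on_imp_line:
  assumes "holo_on f V" "b + s *s v \<in> V"
  shows "((\<lambda>s. f (b + s *s v)) has_field_derivative cgrad f (b + s *s v) v) (at s)"
  using holo_line_derivative[OF holo_onD[OF assms] cgrad_scale] .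

lemma holo_on_imp_line_holomorphic:
  assumes "holo_on f V" "\<And>s. s \<in> S \<Longrightarrow> b + s *s v \<in> V"
  shows "(\<lambda>s. f (b + s *s v)) holomorphic_on S"
  unfolding holomorphic_on_def field_differentiable_def
  using holo_on_imp_line[OF assms(1) assms(2)] has_field_derivative_at_within by blast

lemma cpartial_line:
  assumes "holo_on f V" "b + s *s axis i 1 \<in> V"
  shows "((\<lambda>s. f (b + s *s axis i 1)) has_field_derivative cpartial i f (b + s *s axis i 1)) (at s)"
  using holo_on_imp_line[OF assms] by (simp add: cgrad_axis)

section \<open>Closure properties of holomorphic functions\<close>

lemma holo_on_const: "holo_on (\<lambda>_. c) V"
  unfolding holo_on_def by (auto intro!: exI[of _ "\<lambda>_. 0"])

lemma holo_on_add: 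
  assumes "holo_on f V" "holo_on g V" shows "holo_on (\<lambda>z. f z + g z) V"
  unfolding holo_on_def
proof
  fix z assume z: "z \<in> V"
  show "\<exists>f'. ((\<lambda>z. f z + g z) has_derivative f') (at z) \<and> (\<forall>c v. f' (c *s v) = c * f' v)"
    by (rule exI[of _ "\<lambda>h. cgrad f z h + cgrad g z h"])
       (auto intro!: derivative_intros holo_onD[OF assms(1) z] holo_onD[OF assms(2) z]
          simp: cgrad_scale algebra_simps)
qed

lemma holo_on_mult: 
  assumes "holo_on f V" "holo_on g V" shows "holo_on (\<lambda>z. f z * g z) V"
  unfolding holo_on_def
proof
  fix z assume z: "z \<in> V"
  show "\<exists>f'. ((\<lambda>z. f z * g z) has_derivative f') (at z) \<and> (\<forall>c v. f' (c *s v) = c * f' v)"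
    by (rule exI[of _ "\<lambda>h. f z * cgrad g z h + cgrad f z h * g z"])
       (use has_derivative_mult[OF holo_onD[OF assms(1) z] holo_onD[OF assms(2) z]]
         in \<open>simp add: cgrad_scale distrib_left mult.left_commute mult.assoc\<close>)
qed

lemma holo_on_diff: 
  assumes "holo_on f V" "holo_on g V" shows "holo_on (\<lambda>z. f z - g z) V"
  using holo_on_add[OF assms(1) holo_on_mult[OF holo_on_const[of "-1"] assms(2)]] by simp

lemma holo_on_sum:
  "(\<And>i. i \<in> I \<Longrightarrow> holo_on (f i) V) \<Longrightarrow> holo_on (\<lambda>z. \<Sum>i\<in>I. f i z) V"
  by (induction I rule: infinite_finite_induct) (auto intro: holo_on_const holo_on_add)

lemma cpartial_cong:
  assumes "open V" "\<And>z. z \<in> V \<Longrightarrow> f z = g z" "b \<in> V"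
  shows "cpartial i f b = cpartial i g b"
  unfolding cpartial_def
proof (rule deriv_cong_ev)
  have "open ((\<lambda>s. b + s *s axis i 1) -` V)"
    by (rule open_vimage[OF assms(1)]) (rule continuous_on_vscale)
  then show "\<forall>\<^sub>F s in nhds 0. f (b + s *s axis i 1) = g (b + s *s axis i 1)"
    by (rule eventually_nhds_in_open[THEN eventually_mono]) (use assms in auto)
qed simp

lemma cpartial_add:
  assumes "holo_on f V" "holo_on g V" "b \<in> V"
  shows "cpartial i (\<lambda>z. f z + g z) b = cpartial i f b + cpartial i g b"
  by (subst cpartial_eq[OF has_derivative_add[OF holo_onD[OF assms(1,3)] holo_onD[OF assms(2,3)]]])
     (simp_all add: cgrad_scale cgrad_axis algebra_simps)

lemma cpartial_cmult:
  assumes "holo_on f V" "b \<in> V"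
  shows "cpartial i (\<lambda>z. c * f z) b = c * cpartial i f b"
  by (subst cpartial_eq[OF has_derivative_mult_right[OF holo_onD[OF assms]]])
     (simp_all add: cgrad_scale cgrad_axis algebra_simps)

section \<open>Cauchy estimates, and holomorphy of the partial derivatives\<close>

lemma cball_line:
  fixes b w :: "complex^'n"
  assumes "dist b w \<le> r" "norm s \<le> r'" 
  shows "w + s *s axis i 1 \<in> cball b (r + r')"
proof -
  have "dist b (w + s *s axis i 1) \<le> dist b w + dist w (w + s *s axis i 1)" by (rule dist_triangle)
  also have "dist w (w + s *s axis i 1) = norm s" by (simp add: dist_norm axis_scale_norm)
  finally show ?thesis using assms by simp
qed

text \<open>Cauchy's estimate for the one-variable function on the slice through \<open>b\<close> in
  direction \<open>i\<close>; only values on that slice have to be bounded.\<close>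

lemma cpartial_bound:
  assumes V: "holo_on f V" "cball b r \<subseteq> V" "0 < r"
    and bd: "\<And>s. norm s \<le> r \<Longrightarrow> norm (f (b + s *s axis i 1)) \<le> e"
  shows "norm (cpartial i f b) \<le> e / r"
proof -
  have *: "b + s *s axis i 1 \<in> V" if "s \<in> cball 0 r" for s
    using that V(2) cball_line[of b b 0 s r i] by auto
  have hol: "(\<lambda>s. f (b + s *s axis i 1)) holomorphic_on cball 0 r"
    by (rule holo_on_imp_line_holomorphic[OF V(1) *])
  have "norm ((deriv ^^ 1) (\<lambda>s. f (b + s *s axis i 1)) 0) \<le> fact 1 * e / r^1"
    by (rule Cauchy_inequality) (use hol bd V(3) in \<open>auto intro: holomorphic_on_subset holomorphic_on_imp_continuous_on\<close>)
  then show ?thesis by (simp add: cpartial_def)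
qed

lemma holo_on_compose_translate:
  assumes "holo_on f V" "\<And>z. z \<in> W \<Longrightarrow> z + h \<in> V"
  shows "holo_on (\<lambda>z. f (z + h)) W" "z \<in> W \<Longrightarrow> cpartial i (\<lambda>z. f (z + h)) z = cpartial i f (z + h)"
proof -
  have *: "((\<lambda>z. f (z + h)) has_derivative cgrad f (z + h)) (at z)" if "z \<in> W" for z
  proof -
    have "((\<lambda>z. z + h) has_derivative (\<lambda>x. x)) (at z)" by (auto intro!: derivative_eq_intros)
    from has_derivative_compose[OF this holo_onD[OF assms]] that show ?thesis by simp
  qed
  then show "holo_on (\<lambda>z. f (z + h)) W" unfolding holo_on_def using cgrad_scale by blast
  show "cpartial i (\<lambda>z. f (z + h)) z = cpartial i f (z + h)" if "z \<in> W"
    using cpartial_eq[OF *[OF that] cgrad_scale] by (simp add: cgrad_axis)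
qed

text \<open>The difference of the partial derivatives at \<open>w\<close> and \<open>b\<close> is
  the partial derivative at \<open>b\<close> of the difference between \<open>f\<close> translated
  by \<open>w - b\<close> and \<open>f\<close>. Uniform continuity makes that difference small, and
  Cauchy's estimate passes this on to the derivative.\<close>

lemma continuous_on_cpartial:
  assumes "open V" "holo_on f V"
  shows "continuous_on V (cpartial i f)"
  unfolding continuous_on_iff
proof (intro ballI allI impI)
  fix b e assume b: "b \<in> V" and e: "0 < (e::real)"
  obtain R where R: "R > 0" "cball b R \<subseteq> V" using open_contains_cball assms(1) b by blast
  \<comment> \<open>Half of \<open>R\<close>, so that a slice of radius \<open>r\<close> translated
    by a vector shorter than \<open>r\<close> stays in \<open>cball b R\<close>.\<close>
  define r where "r = R / 2"
  have r: "r > 0" "r + r = R" using R by (auto simp: r_def)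
  have "uniformly_continuous_on (cball b R) f"
    by (intro compact_uniformly_continuous continuous_on_subset[OF holo_on_imp_continuous_on[OF assms(2)] R(2)]) auto
  then obtain d where d: "d > 0" and ud: "\<And>x y. x \<in> cball b R \<Longrightarrow> y \<in> cball b R \<Longrightarrow> dist y x < d \<Longrightarrow> dist (f y) (f x) < e * r / 2"
    using e r unfolding uniformly_continuous_on_def by (metis half_gt_zero mult_pos_pos)
  show "\<exists>d>0. \<forall>x'\<in>V. dist x' b < d \<longrightarrow> dist (cpartial i f x') (cpartial i f b) < e"
  proof (intro exI[of _ "min d r"] conjI ballI impI)
    fix w assume w: "w \<in> V" "dist w b < min d r"
    define h where "h = w - b"
    have sub: "z + h \<in> V" if "z \<in> cball b r" for z
    proof -
      have "dist b (z + h) \<le> dist b z + dist z (z + h)" by (rule dist_triangle)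
      also have "dist z (z + h) = dist w b" by (simp add: h_def dist_norm norm_minus_commute)
      finally show ?thesis using that w r R by auto
    qed
    have ss: "cball b r \<subseteq> V" using R r by auto
    have h1: "holo_on (\<lambda>z. f (z + h)) (cball b r)" by (rule holo_on_compose_translate(1)[OF assms(2) sub])
    have h2: "holo_on (\<lambda>z. -1 * f z) (cball b r)" using holo_on_mult[OF holo_on_const holo_on_subset[OF assms(2) ss]] .
    have bb: "b \<in> cball b r" using r by simp
    \<comment> \<open>The modulus \<open>e * r / 2\<close> was chosen so that division by
      \<open>r\<close> leaves \<open>e / 2\<close>, which is strictly below
      \<open>e\<close>.\<close>
    have "norm (cpartial i (\<lambda>z. f (z + h) + -1 * f z) b) \<le> (e * r / 2) / r"
    proof (rule cpartial_bound[OF holo_on_add[OF h1 h2]])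
      fix s :: complex assume s: "norm s \<le> r"
      have 1: "b + s *s axis i 1 \<in> cball b R" using cball_line[of b b 0 s r i] s r by auto
      have 2: "b + s *s axis i 1 + h \<in> cball b R" 
        using cball_line[of b w r s r i] s r w by (auto simp: h_def dist_commute algebra_simps)
      have "dist (f (b + s *s axis i 1 + h)) (f (b + s *s axis i 1)) < e * r / 2"
        by (rule ud[OF 1 2]) (use w in \<open>auto simp: h_def dist_norm\<close>)
      then show "norm (f (b + s *s axis i 1 + h) + - 1 * f (b + s *s axis i 1)) \<le> e * r / 2"
        by (simp add: dist_norm)
    qed (use r in auto)
    moreover have "cpartial i (\<lambda>z. f (z + h) + -1 * f z) b = cpartial i f w - cpartial i f b"
      using cpartial_add[OF h1 h2 bb] cpartial_cmult[OF assms(2) b, of i "-1"]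
        holo_on_compose_translate(2)[OF assms(2) sub bb, of i] by (simp add: h_def)
    ultimately show "dist (cpartial i f w) (cpartial i f b) < e"
      using r e by (simp add: dist_norm)
  qed (use d r in auto)
qed

text \<open>Partial derivatives are uniformly continuous on the compact ball, and the mean value
  inequality bounds the linearization error by the oscillation of the differential. The point is
  that \<open>d\<close> does not depend on \<open>x\<close>.\<close>

lemma cgrad_uniform_linearization:
  assumes "holo_on f V" "open V" "cball b R \<subseteq> V" "0 < r" "r < R" "0 < e"
  obtains d where "d > 0" "\<And>x h. x \<in> cball b r \<Longrightarrow> norm h < d \<Longrightarrow>
     norm (f (x + h) - f x - cgrad f x h) \<le> e * norm h"
proof -
  \<comment> \<open>Each partial derivative is allowed to oscillate by \<open>e / N\<close>, so that
    the sum over all coordinates stays within \<open>e\<close>.\<close>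
  define N where "N = real CARD('a)"
  have N: "N > 0" by (simp add: N_def)
  have "\<exists>d>0. \<forall>x\<in>cball b R. \<forall>y\<in>cball b R. dist y x < d \<longrightarrow> dist (cpartial i f y) (cpartial i f x) < e / N" for i
  proof -
    have "uniformly_continuous_on (cball b R) (cpartial i f)"
      by (intro compact_uniformly_continuous continuous_on_subset[OF continuous_on_cpartial[OF assms(2,1)] assms(3)]) auto
    then show ?thesis using assms N unfolding uniformly_continuous_on_def by simp
  qed
  then obtain D where D: "\<And>i. D i > 0" 
     "\<And>i x y. x\<in>cball b R \<Longrightarrow> y\<in>cball b R \<Longrightarrow> dist y x < D i \<Longrightarrow> dist (cpartial i f y) (cpartial i f x) < e / N"
    by metis
  \<comment> \<open>The bound \<open>R - r\<close> keeps the \<open>d\<close>-ball around each point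
    of \<open>cball b r\<close> inside \<open>cball b R\<close>, where uniform continuity is
    available.\<close>
  define d where "d = min (R - r) (Min (range D))"
  have d: "d > 0" "d \<le> R - r" "\<And>i. d \<le> D i"
    using D assms by (auto simp: d_def intro: min.coboundedI2)
  show ?thesis
  proof (rule that[OF d(1)])
    fix x h :: "complex^'a" assume x: "x \<in> cball b r" and h: "norm h < d"
    have ballsub: "ball x d \<subseteq> cball b R"
    proof
      fix y assume "y \<in> ball x d"
      then show "y \<in> cball b R" using x d dist_triangle[of b y x] by auto
    qed
    have "norm (f (x + h) - f x - cgrad f x (x + h - x)) \<le> norm (x + h - x) * e"
    proof (rule differentiable_bound_linearization[where S="ball x d"])
      fix t :: real assume "t \<in> {0..1}"
      then have "norm (t *\<^sub>R h) \<le> norm h" by (simp add: mult_left_le_one_le)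
      then show "x + t *\<^sub>R (x + h - x) \<in> ball x d" using h by (simp add: dist_norm)
    next
      fix y assume y: "y \<in> ball x d"
      then show "(f has_derivative cgrad f y) (at y within ball x d)"
        using holo_onD[OF assms(1)] ballsub assms(3) has_derivative_at_withinI by blast
      have *: "norm (cpartial i f y - cpartial i f x) \<le> e / N" for i
        using D(2)[of x y i] y d(3)[of i] ballsub x assms(5) by (auto simp: dist_norm norm_minus_commute)
      show "onorm (cgrad f y - cgrad f x) \<le> e"
        unfolding fun_diff_def
      proof (rule onorm_bound)
        fix v :: "complex^'a"
        have "norm (cgrad f y v - cgrad f x v) = norm (\<Sum>j\<in>UNIV. v$j * (cpartial j f y - cpartial j f x))"
          by (simp add: cgrad_def sum_subtractf[symmetric] algebra_simps)
        also have "\<dots> \<le> (\<Sum>j\<in>(UNIV::'a set). norm v * (e / N))"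
          by (rule sum_norm_le) (unfold norm_mult, intro mult_mono * Finite_Cartesian_Product.norm_nth_le norm_ge_zero)
        also have "\<dots> = e * norm v" using N by (simp add: N_def)
        finally show "norm (cgrad f y v - cgrad f x v) \<le> e * norm v" .
      qed (use assms in simp)
    qed (use d in auto)
    then show "norm (f (x + h) - f x - cgrad f x h) \<le> e * norm h" by (simp add: mult.commute)
  qed
qed

text \<open>Along the line, difference quotients in direction \<open>j\<close> are holomorphic in
  \<open>s\<close>. By the uniform linearization they converge locally uniformly to the partial
  derivative, so the limit is holomorphic by Weierstrass' theorem.\<close>

lemma cpartial_line_holomorphic:
  assumes "open V" "holo_on f V" "\<And>s. s \<in> S \<Longrightarrow> b + s *s axis i 1 \<in> V" "open S"
  shows "(\<lambda>s. cpartial j f (b + s *s axis i 1)) holomorphic_on S"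
proof (rule holomorphic_on_open[THEN iffD2, OF assms(4)], intro ballI)
  fix s0 assume s0: "s0 \<in> S"
  define c where "c = b + s0 *s axis i 1"
  obtain R where R: "R > 0" "cball c R \<subseteq> V"
    using open_contains_cball assms(1,3) s0 c_def by metis
  define r where "r = R / 2"
  have r: "r > 0" "r < R" "r + r = R" using R by (auto simp: r_def)
  \<comment> \<open>The step \<open>r / Suc n\<close> is never zero, tends to zero, and is at most
    \<open>r\<close>, so the shifted point remains in \<open>V\<close> for every
    \<open>n\<close>.\<close>
  define F where "F n s = (f (b + s *s axis i 1 + complex_of_real (r / Suc n) *s axis j 1) - f (b + s *s axis i 1)) / complex_of_real (r / Suc n)" for n s
  have inc: "b + s *s axis i 1 \<in> cball c r" if "s \<in> cball s0 r" for s
  proof -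
    have "b + s *s axis i 1 = c + (s - s0) *s axis i 1" by (simp add: c_def vec_eq_iff algebra_simps)
    then show ?thesis using cball_line[of c c 0 "s - s0" r i] that by (simp add: dist_norm norm_minus_commute)
  qed
  have inc2: "b + s *s axis i 1 + complex_of_real (r / Suc n) *s axis j 1 \<in> V" if "s \<in> cball s0 r" for s n
  proof -
    have "norm (complex_of_real (r / Suc n)) \<le> r" using r by (simp only: norm_of_real) (simp add: divide_le_eq)
    then show ?thesis using cball_line[of c "b + s *s axis i 1" r "complex_of_real (r / Suc n)" r j] inc[OF that] r(3) R(2)
      by auto
  qed
  have "(\<lambda>s. cpartial j f (b + s *s axis i 1)) holomorphic_on ball s0 r"
  proof (rule holomorphic_uniform_sequence[where f=F])
    fix n
    have "(\<lambda>s. f ((b + complex_of_real (r / Suc n) *s axis j 1) + s *s axis i 1)) holomorphic_on ball s0 r"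
      by (rule holo_on_imp_line_holomorphic[OF assms(2)]) (use inc2[of _ n] in \<open>auto simp: algebra_simps\<close>)
    moreover have "(\<lambda>s. f (b + s *s axis i 1)) holomorphic_on ball s0 r"
    proof (rule holo_on_imp_line_holomorphic[OF assms(2)])
      fix s assume "s \<in> ball s0 r"
      then have "b + s *s axis i 1 \<in> cball c r" by (intro inc) auto
      then show "b + s *s axis i 1 \<in> V" using R(2) r by auto
    qed
    ultimately show "F n holomorphic_on ball s0 r"
      unfolding F_def using r by (intro holomorphic_intros) (auto simp: algebra_simps)
  next
    fix x assume x: "x \<in> ball s0 r"
    obtain d where d: "d > 0" "cball x d \<subseteq> ball s0 r" using open_contains_cball open_ball x by blast
    have "uniform_limit (cball x d) F (\<lambda>s. cpartial j f (b + s *s axis i 1)) sequentially"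
      unfolding uniform_limit_iff
    proof (intro allI impI)
      fix e :: real assume e: "e > 0"
      obtain D where D: "D > 0" "\<And>x h. x \<in> cball c r \<Longrightarrow> norm h < D \<Longrightarrow>
          norm (f (x + h) - f x - cgrad f x h) \<le> e / 2 * norm h"
        using cgrad_uniform_linearization[OF assms(2,1) R(2) r(1,2), of "e/2"] e by auto
      have "(\<lambda>n. r / real (Suc n)) \<longlonglongrightarrow> 0" by (rule LIMSEQ_Suc[OF lim_const_over_n])
      then have "\<forall>\<^sub>F n in sequentially. r / Suc n < D" using D(1) by (rule order_tendstoD)
      then show "\<forall>\<^sub>F n in sequentially. \<forall>s\<in>cball x d. dist (F n s) (cpartial j f (b + s *s axis i 1)) < e"
      proof (eventually_elim, intro ballI)
        fix n s assume n: "r / Suc n < D" and s: "s \<in> cball x d"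
        define h where "h = complex_of_real (r / Suc n)"
        have h: "h \<noteq> 0" "norm h < D" using r n unfolding h_def norm_of_real of_real_eq_0_iff by auto
        define y where "y = b + s *s axis i 1"
        have "y \<in> cball c r" using s d inc unfolding y_def by auto
        from D(2)[OF this, of "h *s axis j 1"] h
        have "norm (f (y + h *s axis j 1) - f y - h * cpartial j f y) \<le> e / 2 * norm h"
          by (simp add: axis_scale_norm cgrad_scale cgrad_axis)
        moreover have "F n s - cpartial j f y = (f (y + h *s axis j 1) - f y - h * cpartial j f y) / h"
          using h by (simp add: F_def h_def[symmetric] y_def[symmetric] diff_divide_distrib del: of_nat_Suc of_real_divide)
        ultimately have "norm (F n s - cpartial j f y) \<le> e / 2"
          using h by (simp add: norm_divide divide_le_eq)
        then show "dist (F n s) (cpartial j f (b + s *s axis i 1)) < e"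
          using e by (simp add: dist_norm y_def)
      qed
    qed
    then show "\<exists>d. 0 < d \<and> cball x d \<subseteq> ball s0 r \<and>
        uniform_limit (cball x d) F (\<lambda>s. cpartial j f (b + s *s axis i 1)) sequentially"
      using d by blast
  qed auto
  then show "\<exists>f'. ((\<lambda>s. cpartial j f (b + s *s axis i 1)) has_field_derivative f') (at s0)"
    using r by (auto simp: holomorphic_on_open)
qed

text \<open>Differentiating the linearization error of \<open>f\<close> in direction
  \<open>i\<close> gives the linearization error of \<open>cpartial i f\<close>. Cauchy's estimate
  transfers smallness from the former to the latter.\<close>

lemma cpartial_has_derivative:
  assumes "open V" "holo_on f V" "b \<in> V"
  shows "(cpartial i f has_derivative (\<lambda>h. \<Sum>j\<in>UNIV. h$j * cpartial i (cpartial j f) b)) (at b)"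
proof -
  obtain R where R: "R > 0" "cball b R \<subseteq> V"
    using open_contains_cball assms(1,3) by metis
  define r where "r = R / 2"
  have r: "r > 0" "r < R" "r + r = R" using R by (auto simp: r_def)
  have line: "b + s *s axis i 1 \<in> cball b r" if "s \<in> cball 0 r" for s
    using cball_line[of b b 0 s r i] that by simp
  have lineV: "b + s *s axis i 1 \<in> V" if "s \<in> ball 0 R" for s
    using cball_line[of b b 0 s R i] that R by auto
  have hj: "(\<lambda>s. cpartial j f (b + s *s axis i 1)) holomorphic_on ball 0 R" for j
    by (rule cpartial_line_holomorphic[OF assms(1,2) lineV]) auto
  define L where "L h = (\<Sum>j\<in>UNIV. h$j * cpartial i (cpartial j f) b)" for h
  show ?thesis unfolding has_derivative_at_alt L_def[symmetric]
  proof (intro conjI allI impI)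
    have "linear L" unfolding L_def by (rule linearI) 
      (simp_all add: algebra_simps sum.distrib scaleR_conv_of_real[where 'a=complex] sum_distrib_left)
    then show "bounded_linear L" by (simp add: linear_conv_bounded_linear)
  next
    fix e :: real assume e: "0 < e"
    obtain D where D: "D > 0" "\<And>x h. x \<in> cball b r \<Longrightarrow> norm h < D \<Longrightarrow>
          norm (f (x + h) - f x - cgrad f x h) \<le> e * r * norm h"
      using cgrad_uniform_linearization[OF assms(2,1) R(2) r(1,2), of "e*r"] e r by auto
    show "\<exists>d>0. \<forall>y. norm (y - b) < d \<longrightarrow> norm (cpartial i f y - cpartial i f b - L (y - b)) \<le> e * norm (y - b)"
    proof (intro exI[of _ "min D r"] conjI allI impI)
      fix y assume y: "norm (y - b) < min D r"
      define h where "h = y - b"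
      have h: "norm h < D" "norm h < r" using y by (auto simp: h_def)
      have yV: "y + s *s axis i 1 \<in> V" if "s \<in> ball 0 r" for s
        using cball_line[of b y r s r i] that R r h by (auto simp: h_def dist_norm norm_minus_commute)
      have yV': "y + s *s axis i 1 \<in> V" if "s \<in> cball 0 r" for s
        using cball_line[of b y r s r i] that R r h by (auto simp: h_def dist_norm norm_minus_commute)
      \<comment> \<open>The linearization error of \<open>f\<close> for the fixed increment
        \<open>h\<close>, moved along the \<open>i\<close>-th axis. On the circle of radius
        \<open>r\<close> it is at most \<open>e * r * norm h\<close>, and Cauchy's estimate divides
        this by \<open>r\<close>.\<close>
      define G where "G s = f (y + s *s axis i 1) - f (b + s *s axis i 1) - (\<Sum>j\<in>UNIV. h$j * cpartial j f (b + s *s axis i 1))" for s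
      have Gh: "G holomorphic_on cball 0 r"
        unfolding G_def
        by (intro holomorphic_intros holo_on_imp_line_holomorphic[OF assms(2)] holomorphic_on_subset[OF hj])
           (use r lineV yV' in auto)
      have "norm ((deriv ^^ 1) G 0) \<le> fact 1 * (e * r * norm h) / r ^ 1"
      proof (rule Cauchy_inequality)
        fix s :: complex assume s: "norm (0 - s) = r"
        have "norm (f (b + s *s axis i 1 + h) - f (b + s *s axis i 1) - cgrad f (b + s *s axis i 1) h) \<le> e * r * norm h"
          using D(2)[OF line h(1), of s] s by simp
        then show "norm (G s) \<le> e * r * norm h"
          by (simp add: G_def cgrad_def h_def algebra_simps)
      qed (use r in \<open>auto intro: holomorphic_on_imp_continuous_on Gh holomorphic_on_subset[OF Gh]\<close>)
      moreover have "(G has_field_derivative (cpartial i f y - cpartial i f b - L h)) (at 0)"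
      proof -
        have bV: "b + 0 *s axis i 1 \<in> V" and yV0: "y + 0 *s axis i 1 \<in> V" using assms(3) yV[of 0] r by auto
        have dj: "((\<lambda>s. cpartial j f (b + s *s axis i 1)) has_field_derivative cpartial i (cpartial j f) b) (at 0)" for j
          using hj[of j] R(1) by (simp add: holomorphic_derivI cpartial_def)
        show ?thesis unfolding G_def L_def
          by (intro DERIV_diff DERIV_sum DERIV_cmult dj)
             (use cpartial_line[OF assms(2) bV] cpartial_line[OF assms(2) yV0] in simp_all)
      qed
      ultimately show "norm (cpartial i f y - cpartial i f b - L (y - b)) \<le> e * norm (y - b)"
        using r by (simp add: DERIV_imp_deriv h_def)
    qed (use D r in auto)
  qed
qed

lemma holo_on_cpartial:
  assumes "open V" "holo_on f V"
  shows "holo_on (cpartial i f) V"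
  unfolding holo_on_def
proof
  fix z assume z: "z \<in> V"
  show "\<exists>f'. (cpartial i f has_derivative f') (at z) \<and> (\<forall>c v. f' (c *s v) = c * f' v)"
    by (intro exI conjI, rule cpartial_has_derivative[OF assms z]) (simp add: sum_distrib_left mult.assoc)
qed

text \<open>The \<open>j\<close>-th coefficient of the differential of \<open>cpartial i f\<close>
  was found in the form \<open>cpartial i (cpartial j f)\<close>; evaluating that differential on
  the \<open>j\<close>-th axis gives the symmetry.\<close>

lemma cpartial_commute:
  assumes "open V" "holo_on f V" "b \<in> V"
  shows "cpartial j (cpartial i f) b = cpartial i (cpartial j f) b"
  by (subst cpartial_eq[OF cpartial_has_derivative[OF assms]])
     (simp_all add: sum_distrib_left mult.assoc axis_def if_distrib if_distribR cong: if_cong)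

section \<open>Higher partial derivatives and the identity theorem\<close>

lemma funpow_cpartial_cong:
  assumes "open V" "\<And>z. z \<in> V \<Longrightarrow> f z = g z" "b \<in> V"
  shows "(cpartial i ^^ n) f b = (cpartial i ^^ n) g b"
  using assms(3) by (induction n arbitrary: b) (auto intro: assms cpartial_cong)

lemma holo_on_funpow_cpartial:
  assumes "open V" "holo_on f V" shows "holo_on ((cpartial i ^^ n) f) V"
  by (induction n) (auto intro: assms holo_on_cpartial)

lemma funpow_cpartial_commute:
  assumes "open V" "holo_on f V" "b \<in> V"
  shows "(cpartial i ^^ n) (cpartial j f) b = cpartial j ((cpartial i ^^ n) f) b"
  using assms(3)
proof (induction n arbitrary: b)
  case (Suc n)
  have "(cpartial i ^^ Suc n) (cpartial j f) b = cpartial i (cpartial j ((cpartial i ^^ n) f)) b"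
    using cpartial_cong[OF assms(1) Suc.IH Suc.prems] by simp
  then show ?case
    by (simp add: cpartial_commute[OF assms(1) holo_on_funpow_cpartial[OF assms(1,2)] Suc.prems])
qed simp

text \<open>Replaces \<open>coord_list\<close> in \<open>mpartial\<close> by an arbitrary list, so
  that induction over the coordinates is possible.\<close>

definition mpart_list :: "'n list \<Rightarrow> nat^'n \<Rightarrow> (complex^'n \<Rightarrow> complex) \<Rightarrow> complex^'n \<Rightarrow> complex" where
  "mpart_list xs \<nu> f = foldr (\<lambda>i. cpartial i ^^ (\<nu> $ i)) xs f"

lemma mpart_list_simps [simp]:
  "mpart_list [] \<nu> f = f"
  "mpart_list (i # xs) \<nu> f = (cpartial i ^^ (\<nu> $ i)) (mpart_list xs \<nu> f)"
  by (simp_all add: mpart_list_def)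

lemma mpart_list_cong:
  assumes "open V" "\<And>z. z \<in> V \<Longrightarrow> f z = g z" "b \<in> V"
  shows "mpart_list xs \<nu> f b = mpart_list xs \<nu> g b"
  using assms(3) by (induction xs arbitrary: b) (auto intro: assms funpow_cpartial_cong)

lemma holo_on_mpart_list:
  assumes "open V" "holo_on f V" shows "holo_on (mpart_list xs \<nu> f) V"
  by (induction xs) (auto intro: assms holo_on_funpow_cpartial)

lemma mpart_list_cpartial:
  assumes "open V" "holo_on f V" "b \<in> V"
  shows "mpart_list xs \<nu> (cpartial j f) b = cpartial j (mpart_list xs \<nu> f) b"
  using assms(3)
proof (induction xs arbitrary: b)
  case (Cons i xs)
  have "mpart_list (i # xs) \<nu> (cpartial j f) b = (cpartial i ^^ (\<nu> $ i)) (cpartial j (mpart_list xs \<nu> f)) b"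
    using funpow_cpartial_cong[OF assms(1) Cons.IH Cons.prems] by simp
  then show ?case
    by (simp add: funpow_cpartial_commute[OF assms(1) holo_on_mpart_list[OF assms(1,2)] Cons.prems])
qed simp

text \<open>A distinct list contains \<open>j\<close> at most once, so the raised exponent produces
  one extra derivative, which is commuted to the outside past the coordinates in front of
  \<open>j\<close>.\<close>

lemma mpart_list_plus_axis:
  assumes "open V" "holo_on f V" "b \<in> V" "distinct xs"
  shows "mpart_list xs (\<nu> + axis j 1) f b =
    (if j \<in> set xs then cpartial j (mpart_list xs \<nu> f) b else mpart_list xs \<nu> f b)"
  using assms(3,4)
proof (induction xs arbitrary: b)
  case (Cons i xs)
  have IH: "z \<in> V \<Longrightarrow> mpart_list xs (\<nu> + axis j 1) f z =
    (if j \<in> set xs then cpartial j (mpart_list xs \<nu> f) z else mpart_list xs \<nu> f z)" for z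
    using Cons by simp
  show ?case
  proof (cases "i = j")
    case True
    \<comment> \<open>By distinctness the tail does not contain \<open>j\<close>; only the power at
      the head changes.\<close>
    then have "z \<in> V \<Longrightarrow> mpart_list xs (\<nu> + axis j 1) f z = mpart_list xs \<nu> f z" for z
      using IH Cons.prems by simp
    from funpow_cpartial_cong[OF assms(1) this Cons.prems(1), where i=j and n="Suc (\<nu> $ j)"] True
    show ?thesis by simp
  next
    case False
    note * = funpow_cpartial_cong[OF assms(1) IH Cons.prems(1), where i=i and n="\<nu> $ i"]
    show ?thesis
    proof (cases "j \<in> set xs")
      case True
      with * False show ?thesis
        by (simp add: axis_def funpow_cpartial_commute[OF assms(1) holo_on_mpart_list[OF assms(1,2)] Cons.prems(1)])
    next
      case F: False
      with * False show ?thesis by (simp add: axis_def)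
    qed
  qed
qed simp

lemma funpow_cpartial_lincomb:
  assumes "open V" "holo_on f V" "holo_on g V" "b \<in> V"
  shows "(cpartial i ^^ n) (\<lambda>z. c * f z + g z) b = c * (cpartial i ^^ n) f b + (cpartial i ^^ n) g b"
  using assms(4)
proof (induction n arbitrary: b)
  case (Suc n)
  have "holo_on ((cpartial i ^^ n) f) V" "holo_on ((cpartial i ^^ n) g) V"
    using assms by (auto intro: holo_on_funpow_cpartial)
  then show ?case
    using cpartial_cong[OF assms(1) Suc.IH Suc.prems, where i=i] Suc.prems
    by (simp add: cpartial_add[OF holo_on_mult[OF holo_on_const]] cpartial_cmult)
qed simp

lemma mpart_list_lincomb:
  assumes "open V" "holo_on f V" "holo_on g V" "b \<in> V"
  shows "mpart_list xs \<nu> (\<lambda>z. c * f z + g z) b = c * mpart_list xs \<nu> f b + mpart_list xs \<nu> g b"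
  using assms(4)
proof (induction xs arbitrary: b)
  case (Cons i xs)
  show ?case
    using funpow_cpartial_cong[OF assms(1) Cons.IH Cons.prems, where i=i and n="\<nu> $ i"] Cons.prems assms
    by (simp add: funpow_cpartial_lincomb[OF assms(1)] holo_on_mpart_list)
qed simp

lemma coord_list: "distinct (coord_list :: 'n::finite list)" "set (coord_list :: 'n list) = UNIV"
proof -
  have "\<exists>xs :: 'n list. distinct xs \<and> set xs = UNIV"
    using finite_distinct_list[of "UNIV :: 'n set"] by auto
  from someI_ex[OF this] show "distinct (coord_list :: 'n::finite list)" "set (coord_list :: 'n list) = UNIV"
    by (simp_all add: coord_list_def)
qed

lemma mpartial_eq_list: "mpartial \<nu> f = mpart_list coord_list \<nu> f"
  by (simp add: mpartial_def mpart_list_def)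

lemma mpartial_cong:
  assumes "open V" "\<And>z. z \<in> V \<Longrightarrow> f z = g z" "b \<in> V"
  shows "mpartial \<nu> f b = mpartial \<nu> g b"
  unfolding mpartial_eq_list by (rule mpart_list_cong[OF assms])

lemma mpartial_zero [simp]: "mpartial 0 f = f"
proof -
  have "mpart_list xs 0 f = f" for xs by (induction xs) auto
  then show ?thesis by (simp add: mpartial_eq_list)
qed

lemma holo_on_mpartial:
  assumes "open V" "holo_on f V" shows "holo_on (mpartial \<nu> f) V"
  unfolding mpartial_eq_list by (rule holo_on_mpart_list[OF assms])

lemma mpartial_cpartial:
  assumes "open V" "holo_on f V" "b \<in> V"
  shows "mpartial \<nu> (cpartial j f) b = mpartial (\<nu> + axis j 1) f b"
    and "cpartial j (mpartial \<nu> f) b = mpartial (\<nu> + axis j 1) f b"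
  unfolding mpartial_eq_list
  using mpart_list_cpartial[OF assms] mpart_list_plus_axis[OF assms coord_list(1)]
  by (simp_all add: coord_list)

lemma mpartial_lincomb:
  assumes "open V" "holo_on f V" "holo_on g V" "b \<in> V"
  shows "mpartial \<nu> (\<lambda>z. c * f z + g z) b = c * mpartial \<nu> f b + mpartial \<nu> g b"
  unfolding mpartial_eq_list by (rule mpart_list_lincomb[OF assms])

lemma mpartial_const_0: "mpartial \<nu> (\<lambda>_. 0) b = 0"
  \<comment> \<open>For two zero functions and \<open>c = 1\<close>, linearity says that
    \<open>x = x + x\<close>.\<close>
  using mpartial_lincomb[OF open_UNIV holo_on_const holo_on_const UNIV_I, of \<nu> 1 0 0 b] by simp

lemma mpartial_sum:
  assumes "open V" "\<And>j. j \<in> J \<Longrightarrow> holo_on (f j) V" "b \<in> V"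
  shows "mpartial \<nu> (\<lambda>z. \<Sum>j\<in>J. c j * f j z) b = (\<Sum>j\<in>J. c j * mpartial \<nu> (f j) b)"
  using assms(2)
proof (induction J rule: infinite_finite_induct)
  case (insert j J)
  have "holo_on (\<lambda>z. \<Sum>j\<in>J. c j * f j z) V"
    by (intro holo_on_sum holo_on_mult holo_on_const) (use insert in auto)
  then show ?case using insert by (simp add: mpartial_lincomb[OF assms(1) _ _ assms(3)])
qed (simp_all add: mpartial_const_0)

section \<open>Vanishing of all derivatives at a point, and the identity theorem\<close>

lemma holo_on_cgrad:
  assumes "open V" "holo_on f V"
  shows "holo_on (\<lambda>z. cgrad f z v) V"
  unfolding cgrad_def by (intro holo_on_sum holo_on_mult holo_on_const holo_on_cpartial assms)

text \<open>On the complex line through \<open>b\<close> and \<open>z\<close>, the derivatives of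
  the restriction are iterated directional derivatives of \<open>f\<close>, hence combinations of
  partial derivatives. All vanish at \<open>b\<close>, and the one-variable identity theorem
  applies.\<close>

lemma mpartial_0_imp_zero_ball:
  assumes "holo_on f (ball b r)" "\<And>\<nu>. mpartial \<nu> f b = 0" "z \<in> ball b r"
  shows "f z = 0"
proof (cases "z = b")
  case True
  then show ?thesis using assms(2)[of 0] by simp
next
  case False
  define v where "v = z - b"
  have v: "norm v > 0" using False by (simp add: v_def)
  define D where "D = (\<lambda>g z. cgrad g z v)"
  have r: "r > 0" using assms(3) by (metis ball_empty empty_iff linorder_not_less)
  then have b: "b \<in> ball b r" by simp
  \<comment> \<open>The induction carries all multi-indices, because \<open>D\<close> expresses each
    derivative at \<open>b\<close> through derivatives of the next higher order.\<close>
  have D: "holo_on ((D ^^ k) f) (ball b r) \<and> (\<forall>\<nu>. mpartial \<nu> ((D ^^ k) f) b = 0)" for k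
  proof (induction k)
    case (Suc k)
    define g where "g = (D ^^ k) f"
    have g: "holo_on g (ball b r)" "\<And>\<nu>. mpartial \<nu> g b = 0" using Suc by (auto simp: g_def)
    have "mpartial \<nu> (\<lambda>z. cgrad g z v) b = (\<Sum>j\<in>UNIV. v$j * mpartial \<nu> (cpartial j g) b)" for \<nu>
      unfolding cgrad_def by (rule mpartial_sum[OF open_ball holo_on_cpartial[OF open_ball g(1)] b])
    then have "mpartial \<nu> (\<lambda>z. cgrad g z v) b = 0" for \<nu>
      using mpartial_cpartial(1)[OF open_ball g(1) b] g(2) by simp
    moreover have "(D ^^ Suc k) f = (\<lambda>z. cgrad g z v)" by (simp add: D_def g_def)
    ultimately show ?case using holo_on_cgrad[OF open_ball g(1)] by simp
  qed (use assms in auto)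
  \<comment> \<open>The parameters for which the line stays in \<open>ball b r\<close>; the values 0
    and 1 correspond to \<open>b\<close> and \<open>z\<close>.\<close>
  define S where "S = ball (0::complex) (r / norm v)"
  have line: "b + s *s v \<in> ball b r" if "s \<in> S" for s
    using that v by (simp add: S_def dist_norm norm_vscale pos_less_divide_eq)
  have der: "(deriv ^^ k) (\<lambda>s. f (b + s *s v)) s = (D ^^ k) f (b + s *s v)" if "s \<in> S" for k s
    using that
  proof (induction k arbitrary: s)
    case (Suc k)
    have "(deriv ^^ Suc k) (\<lambda>s. f (b + s *s v)) s = deriv (\<lambda>s. (D ^^ k) f (b + s *s v)) s"
    proof (simp, rule deriv_cong_ev)
      have "\<forall>\<^sub>F s in nhds s. s \<in> S" using Suc.prems by (intro eventually_nhds_in_open) (auto simp: S_def)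
      then show "\<forall>\<^sub>F s in nhds s. (deriv ^^ k) (\<lambda>s. f (b + s *s v)) s = (D ^^ k) f (b + s *s v)"
        by eventually_elim (rule Suc.IH)
    qed simp
    also have "\<dots> = (D ^^ Suc k) f (b + s *s v)"
      using holo_on_imp_line[OF conjunct1[OF D] line[OF Suc.prems]] by (simp add: DERIV_imp_deriv D_def)
    finally show ?case .
  qed simp
  have "(\<lambda>s. f (b + s *s v)) 1 = 0"
  proof (rule holomorphic_fun_eq_0_on_connected[where S=S and z=0 and w=1 and f="\<lambda>s. f (b + s *s v)"])
    show "(\<lambda>s. f (b + s *s v)) holomorphic_on S"
      by (rule holo_on_imp_line_holomorphic[OF assms(1) line])
    show z: "0 \<in> S" using r v by (simp add: S_def)
    show "(deriv ^^ n) (\<lambda>s. f (b + s *s v)) 0 = 0" for n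
    proof -
      have "mpartial 0 ((D ^^ n) f) b = 0" using D by blast
      then show ?thesis using der[OF z, of n] by simp
    qed
    show "1 \<in> S" using assms(3) v by (simp add: S_def v_def dist_norm norm_minus_commute)
  qed (auto simp: S_def)
  then show ?thesis by (simp add: v_def)
qed

lemma eventually_zero_iff_mpartial:
  assumes "open V" "holo_on f V" "b \<in> V"
  shows "eventually (\<lambda>t. f t = 0) (nhds b) \<longleftrightarrow> (\<forall>\<nu>. mpartial \<nu> f b = 0)"
proof
  assume "eventually (\<lambda>t. f t = 0) (nhds b)"
  then obtain S where "open S" "b \<in> S" "\<And>z. z \<in> S \<Longrightarrow> f z = 0" unfolding eventually_nhds by blast
  then show "\<forall>\<nu>. mpartial \<nu> f b = 0"
    using mpartial_cong[of S f "\<lambda>_. 0" b] by (auto simp: mpartial_const_0)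
next
  assume *: "\<forall>\<nu>. mpartial \<nu> f b = 0"
  obtain r where r: "r > 0" "ball b r \<subseteq> V" using assms open_contains_ball by blast
  have "z \<in> ball b r \<Longrightarrow> f z = 0" for z
    by (rule mpartial_0_imp_zero_ball[OF holo_on_subset[OF assms(2) r(2)]]) (use * in auto)
  then show "eventually (\<lambda>t. f t = 0) (nhds b)"
    unfolding eventually_nhds using r(1) by (intro exI[of _ "ball b r"]) auto
qed

text \<open>The points with zero germ form an open set \<open>A\<close>. Every other point of
  \<open>U\<close> has a non-zero partial derivative of some order, so it lies in the open set
  \<open>B\<close>. Connectedness leaves only one of the two.\<close>

lemma holo_on_identity:
  assumes "open U" "connected U" "holo_on f U" "b \<in> U" "eventually (\<lambda>t. f t = 0) (nhds b)" "z \<in> U"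
  shows "f z = 0"
proof -
  define A where "A = {w \<in> U. eventually (\<lambda>t. f t = 0) (nhds w)}"
  define B where "B = (\<Union>\<nu>. {w \<in> U. mpartial \<nu> f w \<noteq> 0})"
  have A: "open A"
    unfolding open_subopen[of A]
  proof
    fix w assume "w \<in> A"
    then have w: "w \<in> U" "eventually (\<lambda>t. f t = 0) (nhds w)" by (auto simp: A_def)
    then obtain S where S: "open S" "w \<in> S" "\<And>z. z \<in> S \<Longrightarrow> f z = 0" unfolding eventually_nhds by blast
    then have "S \<inter> U \<subseteq> A" by (auto simp: A_def eventually_nhds)
    then show "\<exists>T. open T \<and> w \<in> T \<and> T \<subseteq> A" using S w assms(1) by (intro exI[of _ "S \<inter> U"]) auto
  qed
  have "open {w \<in> U. mpartial \<nu> f w \<noteq> 0}" for \<nu>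
  proof -
    have "open (U \<inter> mpartial \<nu> f -` (- {0}))"
      by (rule continuous_open_preimage[OF holo_on_imp_continuous_on[OF holo_on_mpartial[OF assms(1,3)]] assms(1)]) auto
    moreover have "U \<inter> mpartial \<nu> f -` (- {0}) = {w \<in> U. mpartial \<nu> f w \<noteq> 0}" by auto
    ultimately show ?thesis by simp
  qed
  then have B: "open B" unfolding B_def by blast
  have "A \<inter> B \<inter> U = {}" "U \<subseteq> A \<union> B"
    using eventually_zero_iff_mpartial[OF assms(1,3)] by (auto simp: A_def B_def)
  then have "A \<inter> U = {} \<or> B \<inter> U = {}" by (rule connectedD[OF assms(2) A B])
  moreover have "b \<in> A" using assms by (simp add: A_def)
  ultimately have "z \<in> A" using assms(4,6) \<open>U \<subseteq> A \<union> B\<close> by blast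
  then show ?thesis by (auto simp: A_def dest: eventually_nhds_x_imp_x)
qed

text \<open>Otherwise \<open>g\<close> vanishes on the non-empty open set where \<open>f\<close>
  does not, and hence on all of \<open>U\<close> by the identity theorem.\<close>

lemma holo_on_mult_nonzero:
  assumes "open U" "connected U" "holo_on f U" "holo_on g U" "a \<in> U" "f a \<noteq> 0" "b \<in> U" "g b \<noteq> 0"
  shows "\<exists>z\<in>U. f z * g z \<noteq> 0"
proof (rule ccontr)
  assume *: "\<not> ?thesis"
  have "open (U \<inter> f -` (- {0}))"
    by (rule continuous_open_preimage[OF holo_on_imp_continuous_on[OF assms(3)] assms(1)]) auto
  moreover have "z \<in> U \<inter> f -` (- {0}) \<Longrightarrow> g z = 0" for z using * by auto
  ultimately have "eventually (\<lambda>t. g t = 0) (nhds a)"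
    unfolding eventually_nhds using assms(5,6) by (intro exI[of _ "U \<inter> f -` (- {0})"]) auto
  from holo_on_identity[OF assms(1,2,4,5) this assms(7)] assms(8) show False by simp
qed

section \<open>Linear independence as a non-vanishing condition\<close>

text \<open>Independence of an indexed family, read off in the coordinates \<open>I\<close>. With
  indices instead of a set of vectors, a repetition counts as a dependence and the vectors may vary
  with a parameter while \<open>J\<close> stays fixed.\<close>

definition indep_on :: "'i set \<Rightarrow> 'j set \<Rightarrow> ('j \<Rightarrow> 'i \<Rightarrow> complex) \<Rightarrow> bool" where
  "indep_on I J v \<longleftrightarrow> (\<forall>a. (\<forall>p\<in>I. (\<Sum>j\<in>J. a j * v j p) = 0) \<longrightarrow> (\<forall>j\<in>J. a j = 0))"

lemma indep_onD: "indep_on I J v \<Longrightarrow> (\<And>p. p \<in> I \<Longrightarrow> (\<Sum>j\<in>J. a j * v j p) = 0) \<Longrightarrow> j \<in> J \<Longrightarrow> a j = 0"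
  by (auto simp: indep_on_def)

text \<open>One step of elimination without division: with pivot \<open>v j0 p\<close>, each
  remaining vector is scaled by the pivot and its coordinate \<open>p\<close> is cleared. The new
  entries are polynomials in the old ones.\<close>

lemma indep_on_insert:
  assumes J: "finite J" "j0 \<notin> J"
  shows "indep_on I (insert j0 J) v \<longleftrightarrow>
    (\<exists>p\<in>I. v j0 p \<noteq> 0 \<and> indep_on I J (\<lambda>j q. v j0 p * v j q - v j p * v j0 q))"
proof
  assume L: "indep_on I (insert j0 J) v"
  have "\<exists>p\<in>I. v j0 p \<noteq> 0"
  proof (rule ccontr)
    assume "\<not> ?thesis"
    then have "(\<Sum>j\<in>insert j0 J. (if j = j0 then 1 else 0) * v j p) = 0" if "p \<in> I" for p
      using that by (intro sum.neutral) auto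
    from indep_onD[OF L this, of j0] show False by simp
  qed
  then obtain p where p: "p \<in> I" "v j0 p \<noteq> 0" by blast
  have "indep_on I J (\<lambda>j q. v j0 p * v j q - v j p * v j0 q)"
    unfolding indep_on_def
  proof (intro allI impI ballI)
    fix a j assume a: "\<forall>q\<in>I. (\<Sum>j\<in>J. a j * (v j0 p * v j q - v j p * v j0 q)) = 0" and j: "j \<in> J"
    \<comment> \<open>The coefficients obtained by expanding a relation among the reduced vectors in
      terms of the original ones.\<close>
    define c where "c i = (if i = j0 then - (\<Sum>j\<in>J. a j * v j p) else v j0 p * a i)" for i
    have c: "(\<Sum>i\<in>insert j0 J. c i * v i q) = 0" if "q \<in> I" for q
    proof -
      have "(\<Sum>i\<in>J. c i * v i q) = (\<Sum>i\<in>J. v j0 p * a i * v i q)"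
        using J by (intro sum.cong) (auto simp: c_def)
      then have "(\<Sum>i\<in>insert j0 J. c i * v i q) = (\<Sum>i\<in>J. v j0 p * a i * v i q) - (\<Sum>i\<in>J. a i * v i p) * v j0 q"
        using J by (simp add: c_def)
      also have "\<dots> = (\<Sum>i\<in>J. a i * (v j0 p * v i q - v i p * v j0 q))"
        by (simp add: right_diff_distrib sum_subtractf sum_distrib_left sum_distrib_right mult_ac)
      finally show ?thesis using a that by simp
    qed
    have "c j = 0" by (rule indep_onD[OF L c]) (use j in auto)
    then show "a j = 0" using p j J by (auto simp: c_def split: if_splits)
  qed
  then show "\<exists>p\<in>I. v j0 p \<noteq> 0 \<and> indep_on I J (\<lambda>j q. v j0 p * v j q - v j p * v j0 q)"
    using p by blast
next
  assume "\<exists>p\<in>I. v j0 p \<noteq> 0 \<and> indep_on I J (\<lambda>j q. v j0 p * v j q - v j p * v j0 q)"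
  then obtain p where p: "p \<in> I" "v j0 p \<noteq> 0" and R: "indep_on I J (\<lambda>j q. v j0 p * v j q - v j p * v j0 q)" by blast
  show "indep_on I (insert j0 J) v"
    unfolding indep_on_def
  proof (intro allI impI)
    fix a assume a: "\<forall>q\<in>I. (\<Sum>j\<in>insert j0 J. a j * v j q) = 0"
    then have a': "(\<Sum>j\<in>J. a j * v j q) = - a j0 * v j0 q" if "q \<in> I" for q
      using J that by (auto simp: eq_neg_iff_add_eq_0 add.commute)
    have "(\<Sum>j\<in>J. a j * (v j0 p * v j q - v j p * v j0 q)) = 0" if "q \<in> I" for q
    proof -
      have "(\<Sum>j\<in>J. a j * (v j0 p * v j q - v j p * v j0 q)) =
          v j0 p * (\<Sum>j\<in>J. a j * v j q) - v j0 q * (\<Sum>j\<in>J. a j * v j p)"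
        by (simp add: right_diff_distrib sum_subtractf sum_distrib_left mult_ac)
      then show ?thesis using a'[OF that] a'[OF p(1)] by simp
    qed
    then have aJ: "\<forall>j\<in>J. a j = 0" using indep_onD[OF R] by blast
    then have "a j0 * v j0 p = 0" using a'[OF p(1)] by simp
    then show "\<forall>j\<in>insert j0 J. a j = 0" using aJ p by auto
  qed
qed

text \<open>Induction on \<open>J\<close> by elimination, which only multiplies and subtracts
  entries. Leaving the class \<open>A\<close> abstract allows two uses: functions holomorphic on
  \<open>U\<close>, and functions of one variable continuous at 0. The finite set \<open>G\<close>
  serves all \<open>t\<close> at once.\<close>

lemma indep_on_nonvanishing:
  fixes A :: "('t \<Rightarrow> complex) set" and v :: "'t \<Rightarrow> 'j \<Rightarrow> 'i \<Rightarrow> complex"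
  assumes "finite J" "finite I"
    and one: "(\<lambda>_. 1) \<in> A"
    and mult: "\<And>f g. f \<in> A \<Longrightarrow> g \<in> A \<Longrightarrow> (\<lambda>t. f t * g t) \<in> A"
    and diff: "\<And>f g. f \<in> A \<Longrightarrow> g \<in> A \<Longrightarrow> (\<lambda>t. f t - g t) \<in> A"
    and "\<And>j p. j \<in> J \<Longrightarrow> p \<in> I \<Longrightarrow> (\<lambda>t. v t j p) \<in> A"
  shows "\<exists>G. finite G \<and> G \<subseteq> A \<and> (\<forall>t. indep_on I J (v t) \<longleftrightarrow> (\<exists>g\<in>G. g t \<noteq> 0))"
  using assms(1) assms(6)
proof (induction J arbitrary: v rule: finite_induct)
  case empty
  show ?case by (rule exI[of _ "{\<lambda>_. 1}"]) (auto simp: indep_on_def one)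
next
  case (insert j0 J)
  define w where "w p t j q = v t j0 p * v t j q - v t j p * v t j0 q" for p t j q
  have "\<exists>G. finite G \<and> G \<subseteq> A \<and> (\<forall>t. indep_on I J (w p t) \<longleftrightarrow> (\<exists>g\<in>G. g t \<noteq> 0))" if "p \<in> I" for p
    unfolding w_def by (intro insert.IH diff mult insert.prems) (use that in auto)
  then obtain G where G: "\<And>p. p \<in> I \<Longrightarrow> finite (G p) \<and> G p \<subseteq> A \<and> (\<forall>t. indep_on I J (w p t) \<longleftrightarrow> (\<exists>g\<in>G p. g t \<noteq> 0))"
    by metis
  \<comment> \<open>Such a product is non-zero exactly when both the pivot and a test function of
    the reduced family are.\<close>
  define H where "H = (\<Union>p\<in>I. (\<lambda>g t. v t j0 p * g t) ` G p)"
  show ?case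
  proof (intro exI[of _ H] conjI allI)
    show "finite H" using G assms(2) by (auto simp: H_def)
    show "H \<subseteq> A" using G insert.prems by (auto simp: H_def intro!: mult)
    fix t
    have "indep_on I (insert j0 J) (v t) \<longleftrightarrow> (\<exists>p\<in>I. v t j0 p \<noteq> 0 \<and> indep_on I J (w p t))"
      by (subst indep_on_insert[OF insert.hyps]) (simp add: w_def[abs_def])
    also have "\<dots> \<longleftrightarrow> (\<exists>g\<in>H. g t \<noteq> 0)" using G by (auto simp: H_def)
    finally show "indep_on I (insert j0 J) (v t) \<longleftrightarrow> (\<exists>g\<in>H. g t \<noteq> 0)" .
  qed
qed

section \<open>Indexed independence compared with independent sets and dimension\<close>

lemma sum_fun_apply: "(\<Sum>j\<in>J. f j) x = (\<Sum>j\<in>J. f j x)"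
  by (induction J rule: infinite_finite_induct) auto

text \<open>Vectors supported in \<open>I\<close> are zero as soon as their coordinates in
  \<open>I\<close> are. Injectivity appears because the image set forgets repetitions.\<close>

lemma indep_on_iff_independent:
  assumes S: "finite S" and z: "\<And>j p. j \<in> S \<Longrightarrow> p \<notin> I \<Longrightarrow> \<phi> j p = 0"
  shows "indep_on I S \<phi> \<longleftrightarrow> inj_on \<phi> S \<and> cfun.independent (\<phi> ` S)"
proof -
  have eq: "(\<Sum>j\<in>S. fscale (a j) (\<phi> j)) = 0 \<longleftrightarrow> (\<forall>p\<in>I. (\<Sum>j\<in>S. a j * \<phi> j p) = 0)" for a
  proof -
    have "(\<Sum>j\<in>S. a j * \<phi> j p) = 0" if "p \<notin> I" for p using z that by simp
    then show ?thesis by (auto simp: fun_eq_iff sum_fun_apply fscale_def)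
  qed
  show ?thesis
  proof
    assume L: "indep_on I S \<phi>"
    have inj: "inj_on \<phi> S"
    proof (rule inj_onI, rule ccontr)
      fix x y assume xy: "x \<in> S" "y \<in> S" "\<phi> x = \<phi> y" "x \<noteq> y"
      define a where "a j = (if j = x then 1 else if j = y then -1 else 0 :: complex)" for j
      have "(\<Sum>j\<in>S. a j * \<phi> j p) = 0" for p
      proof -
        have "(\<Sum>j\<in>S. a j * \<phi> j p) = (\<Sum>j\<in>S. (if j = x then \<phi> x p else 0) - (if j = y then \<phi> y p else 0))"
          using xy by (intro sum.cong) (auto simp: a_def)
        then show ?thesis using S xy by (simp add: sum_subtractf)
      qed
      from indep_onD[OF L this xy(1)] show False by (simp add: a_def)
    qed
    have "cfun.independent (\<phi> ` S)"
    proof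
      assume "cfun.dependent (\<phi> ` S)"
      then obtain u x where u: "x \<in> S" "u (\<phi> x) \<noteq> 0" "(\<Sum>v\<in>\<phi> ` S. fscale (u v) v) = 0"
        using S by (auto simp: cfun.dependent_finite)
      have "(\<Sum>j\<in>S. fscale (u (\<phi> j)) (\<phi> j)) = 0" using u(3) inj by (simp add: sum.reindex)
      then have "u (\<phi> x) = 0" using indep_onD[OF L _ u(1), of "\<lambda>j. u (\<phi> j)"] eq[of "\<lambda>j. u (\<phi> j)"] by auto
      then show False using u by simp
    qed
    with inj show "inj_on \<phi> S \<and> cfun.independent (\<phi> ` S)" by blast
  next
    assume R: "inj_on \<phi> S \<and> cfun.independent (\<phi> ` S)"
    show "indep_on I S \<phi>" unfolding indep_on_def eq[symmetric]
    proof (intro allI impI ballI)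
      fix a x assume a: "(\<Sum>j\<in>S. fscale (a j) (\<phi> j)) = 0" and x: "x \<in> S"
      define u where "u = (\<lambda>y. a (inv_into S \<phi> y))"
      have "(\<Sum>v\<in>\<phi> ` S. fscale (u v) v) = (\<Sum>j\<in>S. fscale (a j) (\<phi> j))"
        using R by (simp add: sum.reindex u_def)
      then have "u (\<phi> x) = 0" using R S x a by (auto simp: cfun.dependent_finite)
      then show "a x = 0" using R x by (simp add: u_def)
    qed
  qed
qed

lemma card_le_cfun_dim:
  assumes "cfun.independent X" "X \<subseteq> cfun.span Y" "finite Y"
  shows "card X \<le> cfun.dim Y"
proof -
  obtain C where C: "C \<subseteq> Y" "cfun.independent C" "Y \<subseteq> cfun.span C" "card C = cfun.dim Y"
    by (rule cfun.basis_exists)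
  have "X \<subseteq> cfun.span C" using assms(2) C(3) cfun.span_mono cfun.span_span by blast
  then show ?thesis using cfun.independent_span_bound[OF finite_subset[OF C(1) assms(3)] assms(1)] C(4) by auto
qed

lemma card_indep_on_le_dim:
  assumes "finite S" "\<And>j p. j \<in> S \<Longrightarrow> p \<notin> I \<Longrightarrow> \<phi> j p = 0" "indep_on I S \<phi>"
    and "\<phi> ` S \<subseteq> cfun.span Y" "finite Y"
  shows "card S \<le> cfun.dim Y"
  using indep_on_iff_independent[of S I \<phi>] card_le_cfun_dim[of "\<phi> ` S" Y] assms
  by (auto simp: card_image)

text \<open>A basis is chosen inside the image and pulled back to indices, so that the same indices
  can later be followed to other points.\<close>

lemma ex_indep_on_basis:
  assumes "finite B" "\<And>j p. j \<in> B \<Longrightarrow> p \<notin> I \<Longrightarrow> \<phi> j p = 0"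
  obtains S where "S \<subseteq> B" "card S = cfun.dim (\<phi> ` B)" "indep_on I S \<phi>"
    "cfun.span (\<phi> ` S) = cfun.span (\<phi> ` B)"
proof -
  obtain C where C: "C \<subseteq> \<phi> ` B" "cfun.independent C" "\<phi> ` B \<subseteq> cfun.span C" "card C = cfun.dim (\<phi> ` B)"
    by (rule cfun.basis_exists)
  obtain S where S: "S \<subseteq> B" "inj_on \<phi> S" "C = \<phi> ` S" using C(1) by (auto simp: subset_image_inj)
  show ?thesis
  proof (rule that[OF S(1)])
    show "card S = cfun.dim (\<phi> ` B)" using S C by (simp add: card_image)
    have fS: "finite S" using S(1) assms(1) by (rule finite_subset)
    show "indep_on I S \<phi>" using S C indep_on_iff_independent[OF fS, of I \<phi>] assms(2) by (auto simp: subset_iff)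
    show "cfun.span (\<phi> ` S) = cfun.span (\<phi> ` B)"
      using C S cfun.span_mono[of C "\<phi> ` B"] cfun.span_minimal[OF C(3) cfun.subspace_span] by auto
  qed
qed

lemma indep_on_subset:
  assumes "indep_on I J v" "finite J" "K \<subseteq> J" shows "indep_on I K v"
  unfolding indep_on_def
proof (intro allI impI ballI)
  fix a k assume a: "\<forall>p\<in>I. (\<Sum>j\<in>K. a j * v j p) = 0" and k: "k \<in> K"
  have "(\<Sum>j\<in>J. (if j \<in> K then a j else 0) * v j p) = (\<Sum>j\<in>K. a j * v j p)" for p
    using assms by (intro sum.mono_neutral_cong_right) auto
  then have "(if k \<in> K then a k else 0) = 0"
    using indep_onD[OF assms(1), of "\<lambda>j. if j \<in> K then a j else 0" k] a k assms by auto
  then show "a k = 0" using k by simp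
qed

section \<open>Jet spaces\<close>

lemma finite_mi_size_le: "finite {\<nu> :: nat^'n. mi_size \<nu> \<le> k}"
proof (rule finite_subset)
  show "{\<nu> :: nat^'n. mi_size \<nu> \<le> k} \<subseteq> vec_lambda ` (\<Pi>\<^sub>E i\<in>UNIV. {..k})"
  proof
    fix \<nu> :: "nat^'n" assume "\<nu> \<in> {\<nu>. mi_size \<nu> \<le> k}"
    then have "\<nu> $ i \<le> k" for i
      using member_le_sum[of i UNIV "\<lambda>i. \<nu> $ i"] by (simp add: mi_size_def)
    then have "vec_nth \<nu> \<in> (\<Pi>\<^sub>E i\<in>UNIV. {..k})" by auto
    moreover have "\<nu> = vec_lambda (vec_nth \<nu>)" by simp
    ultimately show "\<nu> \<in> vec_lambda ` (\<Pi>\<^sub>E i\<in>UNIV. {..k})" by (metis image_eqI)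
  qed
qed (intro finite_imageI finite_PiE; simp)

lemma mi_size_plus_axis: "mi_size (\<nu> + axis i 1 :: nat^'n) = Suc (mi_size \<nu>)"
proof -
  have "(\<Sum>j\<in>UNIV. (axis i 1 :: nat^'n) $ j) = (\<Sum>j\<in>UNIV. if j = i then 1 else 0)"
    by (intro sum.cong) (auto simp: axis_def)
  then show ?thesis by (simp add: mi_size_def sum.distrib)
qed

lemma mi_fact_plus_axis: "mi_fact (\<nu> + axis i 1) = Suc (\<nu> $ i) * mi_fact \<nu>"
proof -
  have "mi_fact (\<nu> + axis i 1) = (\<Prod>j\<in>UNIV. (if j = i then Suc (\<nu> $ i) else 1) * fact (\<nu> $ j))"
    unfolding mi_fact_def by (intro prod.cong) (auto simp: axis_def)
  then show ?thesis by (simp add: prod.distrib mi_fact_def)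
qed

lemma mi_fact_nonzero: "mi_fact \<nu> \<noteq> 0"
  by (simp add: mi_fact_def)

text \<open>The finite spanning set \<open>B\<close> is fixed once, so that its subsets form one
  finite list of candidates for bases of the jet spaces at all points of \<open>U\<close>.\<close>

locale jet_family =
  fixes U :: "(complex^'n) set" and B Z :: "(complex^'n \<Rightarrow> complex) set"
  assumes open_U: "open U" and finite_B: "finite B" and Z_span: "Z = cfun.span B"
    and holo_Z: "\<And>f. f \<in> Z \<Longrightarrow> holo_on f U"
begin

section \<open>Jet spaces as spans, and their dimensions\<close>

lemma B_subset: "B \<subseteq> Z"
  using cfun.span_superset by (simp add: Z_span)

lemma taylor_coeff_lincomb:
  assumes "f \<in> Z" "g \<in> Z" "b \<in> U"
  shows "taylor_coeff (fscale c f + g) b \<nu> = c * taylor_coeff f b \<nu> + taylor_coeff g b \<nu>"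
proof -
  have "fscale c f + g = (\<lambda>z. c * f z + g z)" by (simp add: fscale_def fun_eq_iff)
  then show ?thesis
    using mpartial_lincomb[OF open_U holo_Z[OF assms(1)] holo_Z[OF assms(2)] assms(3)]
    by (simp add: taylor_coeff_def add_divide_distrib)
qed

lemma jet_lincomb:
  assumes "f \<in> Z" "g \<in> Z" "b \<in> U"
  shows "jet k (fscale c f + g) b = fscale c (jet k f b) + jet k g b"
  using taylor_coeff_lincomb[OF assms] by (auto simp: jet_def fscale_def fun_eq_iff)

lemma jet_zero:
  assumes "b \<in> U" shows "jet k 0 b = 0"
proof -
  have "0 \<in> Z" by (simp add: Z_span cfun.span_zero)
  \<comment> \<open>With both functions zero and \<open>c = -1\<close> the right-hand side
    cancels.\<close>
  from jet_lincomb[OF this this assms, of k "-1"] show ?thesis by simp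
qed

text \<open>Jets at \<open>b\<close> depend linearly on the function, so all dimensions can be
  computed from the finitely many jets of \<open>B\<close>.\<close>

lemma jet_space_span:
  assumes b: "b \<in> U"
  shows "jet_space Z k b = cfun.span ((\<lambda>f. jet k f b) ` B)"
proof
  have "f \<in> Z \<and> jet k f b \<in> cfun.span ((\<lambda>f. jet k f b) ` B)" if "f \<in> cfun.span B" for f
    using that
  proof (induction rule: cfun.span_induct_alt)
    case base
    show ?case unfolding jet_zero[OF b] by (simp only: cfun.span_zero Z_span simp_thms)
  next
    case (step c x y)
    then have x: "x \<in> Z" and y: "y \<in> Z" using B_subset by auto
    have "fscale c x + y \<in> Z"
      using x y unfolding Z_span by (intro cfun.span_add cfun.span_scale)
    moreover have "fscale c (jet k x b) + jet k y b \<in> cfun.span ((\<lambda>f. jet k f b) ` B)"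
      by (rule cfun.span_add[OF cfun.span_scale[OF cfun.span_base]]) (use step in auto)
    ultimately show ?case unfolding jet_lincomb[OF x y b] by blast
  qed
  then show "jet_space Z k b \<subseteq> cfun.span ((\<lambda>f. jet k f b) ` B)" by (auto simp: jet_space_def Z_span)
next
  have ZD: "fscale c x \<in> Z" "x + y \<in> Z" "0 \<in> Z" if "x \<in> Z" "y \<in> Z" for c x y
    using that by (auto simp: Z_span intro: cfun.span_add cfun.span_scale cfun.span_zero)
  have "cfun.subspace (jet_space Z k b)"
    unfolding cfun.subspace_def jet_space_def
  proof (intro conjI ballI allI)
    show "0 \<in> (\<lambda>f. jet k f b) ` Z" using jet_zero[OF b] by (metis Z_span cfun.span_zero imageI)
    fix x assume "x \<in> (\<lambda>f. jet k f b) ` Z"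
    then obtain f where f: "f \<in> Z" "x = jet k f b" by blast
    show "x + y \<in> (\<lambda>f. jet k f b) ` Z" if y: "y \<in> (\<lambda>f. jet k f b) ` Z" for y
    proof -
      obtain g where g: "g \<in> Z" "y = jet k g b" using y by blast
      have "x + y = jet k (f + g) b" using jet_lincomb[OF f(1) g(1) b, of k 1] unfolding f g cfun.scale_one ..
      then show ?thesis using ZD(2)[OF f(1) g(1)] by (rule image_eqI)
    qed
    show "fscale c x \<in> (\<lambda>f. jet k f b) ` Z" for c
    proof -
      have "fscale c x = jet k (fscale c f) b"
        using jet_lincomb[OF f(1) ZD(3)[OF f(1) f(1)] b, of k c] unfolding f jet_zero[OF b] add.right_neutral ..
      then show ?thesis using ZD(1)[OF f(1) f(1)] by (rule image_eqI)
    qed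
  qed
  then show "cfun.span ((\<lambda>f. jet k f b) ` B) \<subseteq> jet_space Z k b"
    by (rule cfun.span_minimal[rotated]) (use B_subset in \<open>auto simp: jet_space_def\<close>)
qed

lemma dim_jet_space:
  "b \<in> U \<Longrightarrow> cfun.dim (jet_space Z k b) = cfun.dim ((\<lambda>f. jet k f b) ` B)"
  by (simp add: jet_space_span)

abbreviation jet_indep :: "nat \<Rightarrow> (complex^'n \<Rightarrow> complex) set \<Rightarrow> complex^'n \<Rightarrow> bool" where
  "jet_indep k S b \<equiv> indep_on {\<nu>. mi_size \<nu> \<le> k} S (\<lambda>f. jet k f b)"

lemma card_le_dim_jet_space:
  assumes "b \<in> U" "S \<subseteq> Z" "finite S" "jet_indep k S b"
  shows "card S \<le> cfun.dim (jet_space Z k b)"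
  unfolding dim_jet_space[OF assms(1)]
proof (rule card_indep_on_le_dim[OF assms(3) _ assms(4)])
  have "jet k f b \<in> jet_space Z k b" if "f \<in> S" for f using that assms(2) by (auto simp: jet_space_def)
  then show "(\<lambda>f. jet k f b) ` S \<subseteq> cfun.span ((\<lambda>f. jet k f b) ` B)"
    using jet_space_span[OF assms(1)] by blast
qed (use finite_B in \<open>auto simp: jet_def\<close>)

lemma ex_jet_basis:
  assumes "b \<in> U"
  obtains S where "S \<subseteq> B" "card S = cfun.dim (jet_space Z k b)" "jet_indep k S b"
    "cfun.span ((\<lambda>f. jet k f b) ` S) = jet_space Z k b"
  unfolding dim_jet_space[OF assms] jet_space_span[OF assms]
  by (rule ex_indep_on_basis[OF finite_B, of "{\<nu>. mi_size \<nu> \<le> k}" "\<lambda>f. jet k f b"]) (auto simp: jet_def)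

text \<open>Turns a lower bound on the rank into finitely many alternatives, each an independence
  condition to which \<open>indep_on_nonvanishing\<close> applies.\<close>

lemma le_dim_jet_space_iff:
  assumes "b \<in> U"
  shows "r \<le> cfun.dim (jet_space Z k b) \<longleftrightarrow> (\<exists>S\<subseteq>B. card S = r \<and> jet_indep k S b)"
proof
  assume r: "r \<le> cfun.dim (jet_space Z k b)"
  obtain S where S: "S \<subseteq> B" "card S = cfun.dim (jet_space Z k b)" "jet_indep k S b"
    by (rule ex_jet_basis[OF assms])
  obtain T where T: "T \<subseteq> S" "card T = r" using r S(2) by (metis obtain_subset_with_card_n)
  have "finite S" using S(1) finite_B by (rule finite_subset)
  then show "\<exists>S\<subseteq>B. card S = r \<and> jet_indep k S b"
    using indep_on_subset[OF S(3) _ T(1)] S T by blast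
next
  assume "\<exists>S\<subseteq>B. card S = r \<and> jet_indep k S b"
  then show "r \<le> cfun.dim (jet_space Z k b)"
    using card_le_dim_jet_space[OF assms] B_subset finite_B finite_subset by (metis subset_trans)
qed

lemma dim_jet_space_le_card: "b \<in> U \<Longrightarrow> cfun.dim (jet_space Z k b) \<le> card B"
  by (rule ex_jet_basis[of b k]) (auto dest: card_mono[OF finite_B])

text \<open>A relation among \<open>l\<close>-jets truncates to one among \<open>k\<close>-jets, so
  independent \<open>k\<close>-jets come from independent \<open>l\<close>-jets.\<close>

lemma dim_jet_space_mono:
  assumes "b \<in> U" "k \<le> l"
  shows "cfun.dim (jet_space Z k b) \<le> cfun.dim (jet_space Z l b)"
proof -
  obtain S where S: "S \<subseteq> B" "card S = cfun.dim (jet_space Z k b)" "jet_indep k S b"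
    by (rule ex_jet_basis[OF assms(1)])
  have "jet_indep l S b"
    unfolding indep_on_def
  proof (intro allI impI)
    fix a assume a: "\<forall>p\<in>{\<nu>. mi_size \<nu> \<le> l}. (\<Sum>j\<in>S. a j * jet l j b p) = 0"
    have "(\<Sum>j\<in>S. a j * jet k j b p) = 0" if "p \<in> {\<nu>. mi_size \<nu> \<le> k}" for p
      using a that assms(2) by (auto simp: jet_def)
    then show "\<forall>j\<in>S. a j = 0" using indep_onD[OF S(3)] by blast
  qed
  then show ?thesis using le_dim_jet_space_iff[OF assms(1)] S by auto
qed

text \<open>Ensures that \<open>Max\<close> in \<open>jet_rank\<close> is a genuine maximum.\<close>

lemma dims_finite: "finite ((\<lambda>t. cfun.dim (jet_space Z k t)) ` U)"
  by (rule finite_subset[of _ "{..card B}"]) (use dim_jet_space_le_card in auto)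

lemma dim_le_jet_rank: "b \<in> U \<Longrightarrow> cfun.dim (jet_space Z k b) \<le> jet_rank U Z k"
  unfolding jet_rank_def by (rule Max_ge[OF dims_finite]) auto

lemma jet_rank_attained:
  assumes "U \<noteq> {}" obtains b where "b \<in> U" "cfun.dim (jet_space Z k b) = jet_rank U Z k"
proof -
  have "jet_rank U Z k \<in> (\<lambda>t. cfun.dim (jet_space Z k t)) ` U"
    unfolding jet_rank_def by (rule Max_in[OF dims_finite]) (use assms in auto)
  then show ?thesis using that by auto
qed

section \<open>Bundle points as non-vanishing sets\<close>

lemma holo_on_taylor_coeff:
  assumes "f \<in> Z" shows "holo_on (\<lambda>b. taylor_coeff f b \<nu>) U"
  unfolding taylor_coeff_def divide_inverse
  by (intro holo_on_mult holo_on_const holo_on_mpartial open_U holo_Z assms)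

text \<open>A global form of analytic openness: the equations of the complement are holomorphic on
  all of \<open>U\<close>, so that products of them can be formed and the identity theorem on
  \<open>U\<close> applies.\<close>

definition nonvanishing :: "(complex^'n) set \<Rightarrow> bool" where
  "nonvanishing W \<longleftrightarrow> (\<exists>G. finite G \<and> (\<forall>g\<in>G. holo_on g U) \<and> W = {t\<in>U. \<exists>g\<in>G. g t \<noteq> 0})"

text \<open>The rank never exceeds its maximum, so having maximal rank is a lower bound: some subset
  of \<open>B\<close> with \<open>jet_rank U Z k\<close> elements has independent jets. The test
  functions of all these subsets are collected.\<close>

lemma nonvanishing_bundle_points_at: "nonvanishing (bundle_points_at U Z k)"
proof -
  have "\<exists>G. finite G \<and> G \<subseteq> {g. holo_on g U} \<and> (\<forall>t. jet_indep k S t \<longleftrightarrow> (\<exists>g\<in>G. g t \<noteq> 0))"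
    if S: "S \<subseteq> B" for S
    using S B_subset finite_subset[OF S finite_B]
    by (intro indep_on_nonvanishing)
      (auto simp: finite_mi_size_le jet_def intro!: holo_on_taylor_coeff holo_on_const intro: holo_on_mult holo_on_diff)
  then obtain G where G: "\<And>S. S \<subseteq> B \<Longrightarrow> finite (G S) \<and> G S \<subseteq> {g. holo_on g U} \<and> (\<forall>t. jet_indep k S t \<longleftrightarrow> (\<exists>g\<in>G S. g t \<noteq> 0))"
    by metis
  define H where "H = (\<Union>S\<in>{S. S \<subseteq> B \<and> card S = jet_rank U Z k}. G S)"
  show ?thesis unfolding nonvanishing_def
  proof (intro exI[of _ H] conjI)
    show "finite H" using G finite_B by (auto simp: H_def)
    show "\<forall>g\<in>H. holo_on g U" using G by (auto simp: H_def)
    have "cfun.dim (jet_space Z k t) = jet_rank U Z k \<longleftrightarrow> (\<exists>g\<in>H. g t \<noteq> 0)" if t: "t \<in> U" for t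
    proof -
      have "cfun.dim (jet_space Z k t) = jet_rank U Z k \<longleftrightarrow> jet_rank U Z k \<le> cfun.dim (jet_space Z k t)"
        using dim_le_jet_rank[OF t, of k] by auto
      also have "\<dots> \<longleftrightarrow> (\<exists>g\<in>H. g t \<noteq> 0)"
      proof -
        have "jet_indep k S t \<longleftrightarrow> (\<exists>g\<in>G S. g t \<noteq> 0)" if "S \<subseteq> B" for S using G[OF that] by blast
        then have "(S \<subseteq> B \<and> card S = jet_rank U Z k \<and> jet_indep k S t) \<longleftrightarrow>
            (S \<subseteq> B \<and> card S = jet_rank U Z k \<and> (\<exists>g\<in>G S. g t \<noteq> 0))" for S by blast
        then have "(\<exists>S\<subseteq>B. card S = jet_rank U Z k \<and> jet_indep k S t) \<longleftrightarrow>
            (\<exists>S\<subseteq>B. card S = jet_rank U Z k \<and> (\<exists>g\<in>G S. g t \<noteq> 0))" by presburger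
        also have "\<dots> \<longleftrightarrow> (\<exists>g\<in>H. g t \<noteq> 0)" by (force simp: H_def)
        finally show ?thesis unfolding le_dim_jet_space_iff[OF t] .
      qed
      finally show ?thesis .
    qed
    then show "bundle_points_at U Z k = {t\<in>U. \<exists>g\<in>H. g t \<noteq> 0}" by (auto simp: bundle_points_at_def)
  qed
qed

text \<open>Pairwise products of the two families of functions define the intersection, and it has a
  point because a product of non-zero holomorphic functions on a connected set is non-zero.\<close>

lemma nonvanishing_Int:
  assumes "connected U" "nonvanishing V" "nonvanishing W"
  shows "nonvanishing (V \<inter> W)" and "V \<noteq> {} \<Longrightarrow> W \<noteq> {} \<Longrightarrow> V \<inter> W \<noteq> {}"
proof -
  obtain G H where G: "finite G" "\<forall>g\<in>G. holo_on g U" "V = {t\<in>U. \<exists>g\<in>G. g t \<noteq> 0}"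
    and H: "finite H" "\<forall>g\<in>H. holo_on g U" "W = {t\<in>U. \<exists>g\<in>H. g t \<noteq> 0}"
    using assms unfolding nonvanishing_def by blast
  show "nonvanishing (V \<inter> W)" unfolding nonvanishing_def
    by (rule exI[of _ "(\<lambda>(g, h) t. g t * h t) ` (G \<times> H)"]) (use G H in \<open>auto intro: holo_on_mult\<close>)
  show "V \<inter> W \<noteq> {}" if ne: "V \<noteq> {}" "W \<noteq> {}"
  proof -
    obtain g a h b where "g \<in> G" "a \<in> U" "g a \<noteq> 0" "h \<in> H" "b \<in> U" "h b \<noteq> 0" using ne G H by auto
    with holo_on_mult_nonzero[OF open_U assms(1), of g h a b] G H show ?thesis by auto
  qed
qed

text \<open>The maximal ranks form an increasing sequence bounded by \<open>card B\<close>, hence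
  are constant from some \<open>K\<close> on; maximal rank at level \<open>K\<close> then forces
  maximal rank at all higher levels.\<close>

lemma bundle_points_finite_Inter:
  assumes "U \<noteq> {}" obtains K where "bundle_points U Z = (\<Inter>k\<le>K. bundle_points_at U Z k)"
proof -
  have mono: "jet_rank U Z k \<le> jet_rank U Z l" if "k \<le> l" for k l
    by (metis jet_rank_attained[OF assms] dim_jet_space_mono that dim_le_jet_rank order_trans)
  have bd: "jet_rank U Z k \<le> card B" for k
    by (metis jet_rank_attained[OF assms] dim_jet_space_le_card)
  have "\<exists>K. \<forall>k\<ge>K. jet_rank U Z k = jet_rank U Z K"
  proof -
    have f: "finite (range (jet_rank U Z))" by (rule finite_subset[of _ "{..card B}"]) (use bd in auto)
    then have "Max (range (jet_rank U Z)) \<in> range (jet_rank U Z)" by (intro Max_in) auto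
    then obtain K where K: "jet_rank U Z K = Max (range (jet_rank U Z))" by auto
    have "jet_rank U Z k \<le> jet_rank U Z K" for k unfolding K by (rule Max_ge[OF f]) simp
    then show ?thesis using mono by (intro exI[of _ K]) (auto intro: antisym)
  qed
  then obtain K where K: "\<And>k. k \<ge> K \<Longrightarrow> jet_rank U Z k = jet_rank U Z K" by blast
  \<comment> \<open>At a bundle point of level \<open>K\<close> the rank at level \<open>k\<close>
    lies between the rank at level \<open>K\<close> and the maximum at level \<open>k\<close>, which
    coincide.\<close>
  have "bundle_points_at U Z K \<subseteq> bundle_points_at U Z k" if "k \<ge> K" for k
    using K[OF that] dim_jet_space_mono[OF _ that] dim_le_jet_rank[of _ k]
    by (force simp: bundle_points_at_def intro: antisym)
  then have "bundle_points U Z = (\<Inter>k\<le>K. bundle_points_at U Z k)"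
    unfolding bundle_points_def by (auto) (metis atMost_iff linorder_le_cases order_refl subsetD)
  then show ?thesis using that by blast
qed

lemma nonvanishing_bundle_points:
  assumes "connected U" "U \<noteq> {}"
  shows "nonvanishing (bundle_points U Z)" and "bundle_points U Z \<noteq> {}"
proof -
  obtain K where K: "bundle_points U Z = (\<Inter>k\<le>K. bundle_points_at U Z k)"
    by (rule bundle_points_finite_Inter[OF assms(2)])
  have ne: "bundle_points_at U Z k \<noteq> {}" for k
    by (rule jet_rank_attained[OF assms(2), of k]) (auto simp: bundle_points_at_def)
  have "nonvanishing (\<Inter>k\<le>K. bundle_points_at U Z k) \<and> (\<Inter>k\<le>K. bundle_points_at U Z k) \<noteq> {}" for K
  proof (induction K)
    case (Suc K)
    then show ?case
      using nonvanishing_Int[OF assms(1) nonvanishing_bundle_points_at[of "Suc K"]] ne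
      by (simp add: atMost_Suc)
  qed (simp add: nonvanishing_bundle_points_at ne)
  then show "nonvanishing (bundle_points U Z)" "bundle_points U Z \<noteq> {}" using K by auto
qed

lemma analytically_open_nonvanishing:
  assumes "nonvanishing W" shows "analytically_open U W"
proof -
  obtain G where G: "finite G" "\<forall>g\<in>G. holo_on g U" "W = {t\<in>U. \<exists>g\<in>G. g t \<noteq> 0}"
    using assms unfolding nonvanishing_def by blast
  have "closed_analytic_subset U {t\<in>U. \<forall>g\<in>G. g t = 0}"
    unfolding closed_analytic_subset_def
  proof (intro conjI ballI)
    fix a assume "a \<in> U"
    then show "\<exists>V G'. open V \<and> a \<in> V \<and> V \<subseteq> U \<and> finite G' \<and> (\<forall>g\<in>G'. holo_on g V) \<and>
        {t\<in>U. \<forall>g\<in>G. g t = 0} \<inter> V = {z\<in>V. \<forall>g\<in>G'. g z = 0}"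
      using G open_U by (intro exI[of _ U] exI[of _ G]) auto
  qed auto
  moreover have "W = U - {t\<in>U. \<forall>g\<in>G. g t = 0}" using G by auto
  ultimately show ?thesis unfolding analytically_open_def by blast
qed

end

section \<open>Least spaces\<close>

lemma lookup_pderiv_at:
  "Poly_Mapping.lookup (pderiv_at i p) \<nu> = of_nat (Suc (\<nu> $ i)) * Poly_Mapping.lookup p (\<nu> + axis i 1)"
proof -
  have eq: "Poly_Mapping.lookup (Poly_Mapping.single (\<mu> - axis i 1) (of_nat (\<mu> $ i) * Poly_Mapping.lookup p \<mu>)) \<nu> =
      (if \<mu> = \<nu> + axis i 1 then of_nat (Suc (\<nu> $ i)) * Poly_Mapping.lookup p (\<nu> + axis i 1) else 0)" for \<mu>
  \<comment> \<open>When this exponent is 0, the truncated difference is \<open>\<mu>\<close> itself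
    and may equal \<open>\<nu>\<close>, but the factor annihilates the term.\<close>
  proof (cases "\<mu> $ i = 0")
    case True
    then have "\<mu> \<noteq> \<nu> + axis i 1" by (auto simp: vec_eq_iff axis_def)
    then show ?thesis using True by simp
  next
    case False
    then have "\<mu> - axis i 1 = \<nu> \<longleftrightarrow> \<mu> = \<nu> + axis i 1"
      by (auto simp: vec_eq_iff axis_def split: if_splits)
    then show ?thesis by (auto simp: lookup_single when_def axis_def)
  qed
  have "Poly_Mapping.lookup (pderiv_at i p) \<nu> = (\<Sum>\<mu>\<in>Poly_Mapping.keys p.
      (if \<mu> = \<nu> + axis i 1 then of_nat (Suc (\<nu> $ i)) * Poly_Mapping.lookup p (\<nu> + axis i 1) else 0))"
    by (simp add: pderiv_at_def lookup_sum eq del: One_nat_def)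
  then show ?thesis by (simp add: in_keys_iff)
qed

lemma pderiv_at_lincomb: "pderiv_at i (pscale c p + q) = pscale c (pderiv_at i p) + pderiv_at i q"
  by (rule poly_mapping_eqI) (simp add: lookup_pderiv_at lookup_add lookup_pscale algebra_simps)

lemma pderiv_at_0: "pderiv_at i 0 = 0"
  by (rule poly_mapping_eqI) (simp add: lookup_pderiv_at)

lemma D_invariant_span:
  assumes "\<And>i p. p \<in> P \<Longrightarrow> pderiv_at i p \<in> cpoly.span P"
  shows "D_invariant (cpoly.span P)"
  unfolding D_invariant_def
proof (intro conjI allI ballI)
  fix i p assume "p \<in> cpoly.span P"
  then show "pderiv_at i p \<in> cpoly.span P"
    by (induction rule: cpoly.span_induct_alt)
      (auto simp: pderiv_at_0 pderiv_at_lincomb cpoly.span_zero intro!: cpoly.span_add cpoly.span_scale assms)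
qed (rule cpoly.subspace_span)

lemma lookup_least_part:
  fixes f :: "complex^'n \<Rightarrow> complex"
  assumes "\<not> eventually (\<lambda>t. f t = 0) (nhds b)" "taylor_coeff f b \<mu> \<noteq> 0" "mi_size \<mu> = k"
    and "\<And>\<nu>. mi_size \<nu> < k \<Longrightarrow> taylor_coeff f b \<nu> = 0"
  shows "Poly_Mapping.lookup (least_part b f) \<nu> = (if mi_size \<nu> = k then taylor_coeff f b \<nu> else 0)"
proof -
  have "(LEAST m. \<exists>\<nu>. mi_size \<nu> = m \<and> taylor_coeff f b \<nu> \<noteq> 0) = k"
  proof (rule Least_equality)
    show "\<exists>\<nu>. mi_size \<nu> = k \<and> taylor_coeff f b \<nu> \<noteq> 0" using assms(2,3) by blast
    show "k \<le> m" if "\<exists>\<nu>. mi_size \<nu> = m \<and> taylor_coeff f b \<nu> \<noteq> 0" for m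
      using that assms(4) by (metis not_le)
  qed
  moreover have "finite {\<nu> :: nat^'n. mi_size \<nu> = k}"
    by (rule finite_subset[OF _ finite_mi_size_le[of k]]) auto
  ultimately show ?thesis using assms(1)
    by (simp add: least_part_def Let_def lookup_sum lookup_single when_def)
qed

section \<open>Differentiation at bundle points and invariance of the least space\<close>

context jet_family
begin

text \<open>The factor is the quotient of \<open>mi_fact (\<nu> + axis i 1)\<close> by
  \<open>mi_fact \<nu>\<close>. It agrees with the one in \<open>lookup_pderiv_at\<close>, which is
  why analytic and formal derivatives match.\<close>

lemma cpartial_taylor_coeff:
  assumes "f \<in> Z" "b \<in> U"
  shows "cpartial i (\<lambda>t. taylor_coeff f t \<nu>) b = of_nat (Suc (\<nu> $ i)) * taylor_coeff f b (\<nu> + axis i 1)"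
proof -
  have "cpartial i (\<lambda>t. taylor_coeff f t \<nu>) b = cpartial i (mpartial \<nu> f) b / of_nat (mi_fact \<nu>)"
    using cpartial_cmult[OF holo_on_mpartial[OF open_U holo_Z[OF assms(1)]] assms(2), of i "inverse (of_nat (mi_fact \<nu>))" \<nu>]
    by (simp add: taylor_coeff_def divide_inverse mult.commute)
  then show ?thesis
    using mpartial_cpartial(2)[OF open_U holo_Z[OF assms(1)] assms(2)] mi_fact_nonzero[of \<nu>]
    by (simp add: taylor_coeff_def mi_fact_plus_axis del: of_nat_Suc One_nat_def mult_Suc)
qed

text \<open>If the derivative \<open>w\<close> of the jet of \<open>f\<close> were outside the jet space at \<open>b\<close>, it would be
  independent of a basis; the difference quotients, which are multiples of jets of \<open>f\<close>, would then
  raise the rank above the generic one at nearby points.\<close>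

lemma ex_jet_eq_derivative:
  assumes b: "b \<in> bundle_points_at U Z k" and f: "f \<in> Z" "jet k f b = 0"
  shows "\<exists>g\<in>Z. jet k g b = (\<lambda>\<nu>. if mi_size \<nu> \<le> k then cpartial i (\<lambda>t. taylor_coeff f t \<nu>) b else 0)"
proof (rule ccontr)
  define w where "w = (\<lambda>\<nu>. if mi_size \<nu> \<le> k then cpartial i (\<lambda>t. taylor_coeff f t \<nu>) b else 0)"
  define I where "I = {\<nu> :: nat^'n. mi_size \<nu> \<le> k}"
  define \<gamma> where "\<gamma> = (\<lambda>s. b + s *s axis i (1::complex))"
  assume "\<not> ?thesis"
  then have w: "w \<notin> jet_space Z k b" unfolding w_def[symmetric] jet_space_def by blast
  have bU: "b \<in> U" and rank: "cfun.dim (jet_space Z k b) = jet_rank U Z k"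
    using b by (auto simp: bundle_points_at_def)
  obtain S where S: "S \<subseteq> B" "card S = cfun.dim (jet_space Z k b)" "jet_indep k S b"
    "cfun.span ((\<lambda>f. jet k f b) ` S) = jet_space Z k b"
    by (rule ex_jet_basis[OF bU])
  have fS: "finite S" using S(1) finite_B by (rule finite_subset)
  \<comment> \<open>Independence at \<open>b\<close> is passed to the set version here, because
    adjoining \<open>w\<close> is a statement about spans.\<close>
  have ind: "inj_on (\<lambda>f. jet k f b) S \<and> cfun.independent ((\<lambda>f. jet k f b) ` S)"
    by (rule indep_on_iff_independent[OF fS, THEN iffD1, OF _ S(3)]) (simp add: jet_def)
  \<comment> \<open>The jet of \<open>f\<close> at \<open>b\<close> is zero, so \<open>f\<close>
    cannot belong to an independent family; inserting it really increases the cardinality.\<close>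
  have fnS: "f \<notin> S"
  proof
    assume "f \<in> S"
    from imageI[OF this, of "\<lambda>f. jet k f b"] have "0 \<in> (\<lambda>f. jet k f b) ` S" unfolding f(2) .
    from cfun.dependent_zero[OF this] ind show False by simp
  qed
  \<comment> \<open>Since the jet of \<open>f\<close> vanishes at \<open>b\<close>, dividing its jet
    at \<open>\<gamma> s\<close> by \<open>s\<close> gives the difference quotient, and
    \<open>w\<close> is the value that makes this continuous at \<open>s = 0\<close>.\<close>
  define v where "v = (\<lambda>s j p. if j = f then (if s = 0 then w p else jet k f (\<gamma> s) p / s) else jet k j (\<gamma> s) p)"
  have SZ: "S \<subseteq> Z" using S(1) B_subset by auto
  have v0: "v 0 f = w" "\<And>j. j \<in> S \<Longrightarrow> v 0 j = jet k j b"
    using fnS by (auto simp: v_def \<gamma>_def)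
  have indep0: "indep_on I (insert f S) (v 0)"
  proof (subst indep_on_iff_independent)
    have img: "v 0 ` insert f S = insert w ((\<lambda>f. jet k f b) ` S)"
    proof -
      have "v 0 ` S = (\<lambda>f. jet k f b) ` S" by (rule image_cong) (simp_all add: v0)
      then show ?thesis by (simp add: v0(1))
    qed
    have "inj_on (v 0) (insert f S)"
    proof -
      have "inj_on (v 0) S \<longleftrightarrow> inj_on (\<lambda>f. jet k f b) S"
        by (rule inj_on_cong) (rule v0(2))
      moreover have "v 0 f \<notin> v 0 ` (S - {f})"
      proof
        assume "v 0 f \<in> v 0 ` (S - {f})"
        then obtain g where "g \<in> S" "w = jet k g b" using v0 by auto
        then show False using w SZ by (auto simp: jet_space_def)
      qed
      ultimately show ?thesis using ind by (simp add: inj_on_insert)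
    qed
    moreover have "cfun.independent (v 0 ` insert f S)"
      unfolding img by (rule cfun.independent_insertI) (use ind w S(4) in simp_all)
    ultimately show "inj_on (v 0) (insert f S) \<and> cfun.independent (v 0 ` insert f S)" by blast
  qed (use fS in \<open>auto simp: v_def w_def I_def jet_def\<close>)
  \<comment> \<open>With the class of functions continuous at 0, independence at
    \<open>s = 0\<close> is witnessed by some \<open>g\<close> with \<open>g 0\<close> non-zero, and
    so persists for small \<open>s\<close>.\<close>
  have "\<exists>G. finite G \<and> G \<subseteq> {g :: complex \<Rightarrow> complex. isCont g 0} \<and> (\<forall>s. indep_on I (insert f S) (v s) \<longleftrightarrow> (\<exists>g\<in>G. g s \<noteq> 0))"
  proof (rule indep_on_nonvanishing)
    fix j p assume j: "j \<in> insert f S" and p: "p \<in> I"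
    have jZ: "j \<in> Z" using j SZ f by auto
    have line: "((\<lambda>s. taylor_coeff j (\<gamma> s) p) has_field_derivative cpartial i (\<lambda>t. taylor_coeff j t p) b) (at 0)"
      using cpartial_line[OF holo_on_taylor_coeff[OF jZ, of p], of b 0 i] bU by (simp add: \<gamma>_def)
    show "(\<lambda>s. v s j p) \<in> {g. isCont g 0}"
    proof (cases "j = f")
      case False
      then show ?thesis using DERIV_isCont[OF line] p by (simp add: v_def jet_def I_def)
    next
      case True
      have "jet k f b p = 0" using f(2) by simp
      then have z: "taylor_coeff f (\<gamma> 0) p = 0" using p by (simp add: jet_def I_def \<gamma>_def)
      have "((\<lambda>s. taylor_coeff f (\<gamma> s) p / s) \<longlongrightarrow> w p) (at 0)"
        using line p True z unfolding DERIV_def by (simp add: w_def I_def)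
      then have "((\<lambda>s. v s j p) \<longlongrightarrow> w p) (at 0)"
        by (rule Lim_transform_eventually) (use p True in \<open>auto simp: v_def jet_def I_def eventually_at_filter\<close>)
      moreover have "v 0 j p = w p" using v0(1) True by simp
      ultimately show ?thesis by (simp add: isCont_def)
    qed
  qed (use fS in \<open>auto simp: I_def finite_mi_size_le intro: continuous_intros\<close>)
  then obtain G where G: "G \<subseteq> {g :: complex \<Rightarrow> complex. isCont g 0}"
    "\<And>s. indep_on I (insert f S) (v s) \<longleftrightarrow> (\<exists>g\<in>G. g s \<noteq> 0)" by blast
  then obtain g where g0: "g \<in> G" "g 0 \<noteq> 0" using indep0 by blast
  have g: "isCont g 0" "g 0 \<noteq> 0" "\<And>s. g s \<noteq> 0 \<Longrightarrow> indep_on I (insert f S) (v s)"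
    using g0 G by auto
  have "\<forall>\<^sub>F s in at 0. g s \<noteq> 0"
    using g(1,2) unfolding isCont_def by (rule tendsto_imp_eventually_ne)
  moreover have "\<forall>\<^sub>F s in at 0. \<gamma> s \<in> U"
  proof -
    have "isCont \<gamma> 0" unfolding \<gamma>_def using continuous_on_vscale[of UNIV b "axis i 1"]
      by (simp add: continuous_on_eq_continuous_at)
    then have "(\<gamma> \<longlongrightarrow> b) (at 0)" by (simp add: isCont_def \<gamma>_def)
    then show ?thesis by (rule topological_tendstoD[OF _ open_U bU])
  qed
  moreover have "\<forall>\<^sub>F s in at (0::complex). s \<noteq> 0" by (simp add: eventually_at_filter)
  ultimately have "\<forall>\<^sub>F s in at 0. g s \<noteq> 0 \<and> \<gamma> s \<in> U \<and> s \<noteq> 0" by eventually_elim blast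
  then obtain s where s: "g s \<noteq> 0" "\<gamma> s \<in> U" "s \<noteq> 0"
    using eventually_happens'[OF at_neq_bot] by blast
  have "jet_indep k (insert f S) (\<gamma> s)"
    unfolding indep_on_def
  proof (intro allI impI ballI)
    fix a j assume a: "\<forall>p\<in>{\<nu>. mi_size \<nu> \<le> k}. (\<Sum>j\<in>insert f S. a j * jet k j (\<gamma> s) p) = 0" and j: "j \<in> insert f S"
    \<comment> \<open>The factor \<open>s\<close> undoes the division in \<open>v\<close>, so a
      relation among the jets at \<open>\<gamma> s\<close> becomes one among the vectors
      \<open>v s\<close>.\<close>
    define c where "c = (\<lambda>j. if j = f then s * a f else a j)"
    have "(\<Sum>j\<in>insert f S. c j * v s j p) = (\<Sum>j\<in>insert f S. a j * jet k j (\<gamma> s) p)" for p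
      using s(3) by (intro sum.cong) (auto simp: c_def v_def)
    then have "c j = 0" using indep_onD[OF g(3)[OF s(1)] _ j, of c] a by (simp add: I_def)
    then show "a j = 0" using s(3) by (auto simp: c_def split: if_splits)
  qed
  then have "card (insert f S) \<le> cfun.dim (jet_space Z k (\<gamma> s))"
    using s(2) SZ f(1) fS by (intro card_le_dim_jet_space) auto
  also have "\<dots> \<le> card S" using dim_le_jet_rank[OF s(2)] S(2) rank by simp
  finally show False using fS fnS by simp
qed

text \<open>For \<open>k = Suc m\<close>, the function \<open>g\<close> given by
  \<open>ex_jet_eq_derivative\<close> for \<open>m\<close>-jets has in degree \<open>m\<close> the
  coefficients of the formal derivative, and below \<open>m\<close> only multiples of coefficients
  of \<open>f\<close> of degree less than \<open>k\<close>, which vanish.\<close>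

lemma pderiv_at_least_part:
  assumes b: "b \<in> bundle_points U Z" and f: "f \<in> Z"
  shows "\<exists>g\<in>Z. pderiv_at i (least_part b f) = least_part b g"
proof (cases "eventually (\<lambda>t. f t = 0) (nhds b)")
  case True
  then have "least_part b f = 0" by (simp add: least_part_def)
  then show ?thesis using f by (auto simp: pderiv_at_0 intro!: bexI[of _ f])
next
  case ne: False
  have bU: "b \<in> U" using b by (auto simp: bundle_points_def bundle_points_at_def)
  have zZ: "0 \<in> Z" by (simp add: Z_span cfun.span_zero)
  have z: "least_part b 0 = 0" by (simp add: least_part_def)
  have tc: "taylor_coeff g b \<nu> = 0 \<longleftrightarrow> mpartial \<nu> g b = 0" for g \<nu>
    using mi_fact_nonzero[of \<nu>] by (simp add: taylor_coeff_def)
  define k where "k = (LEAST m. \<exists>\<nu>. mi_size \<nu> = m \<and> taylor_coeff f b \<nu> \<noteq> 0)"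
  have "\<exists>m \<nu>. mi_size \<nu> = m \<and> taylor_coeff f b \<nu> \<noteq> 0"
    using ne eventually_zero_iff_mpartial[OF open_U holo_Z[OF f] bU] tc by auto
  from LeastI_ex[OF this] obtain \<mu> where \<mu>: "mi_size \<mu> = k" "taylor_coeff f b \<mu> \<noteq> 0"
    unfolding k_def[symmetric] by blast
  have low: "taylor_coeff f b \<nu> = 0" if "mi_size \<nu> < k" for \<nu>
    using not_less_Least[of "mi_size \<nu>" "\<lambda>m. \<exists>\<nu>. mi_size \<nu> = m \<and> taylor_coeff f b \<nu> \<noteq> 0"] that
    unfolding k_def[symmetric] by blast
  note lp = lookup_least_part[OF ne \<mu>(2,1) low]
  have pd: "Poly_Mapping.lookup (pderiv_at i (least_part b f)) \<nu> =
      (if Suc (mi_size \<nu>) = k then of_nat (Suc (\<nu> $ i)) * taylor_coeff f b (\<nu> + axis i 1) else 0)" for \<nu>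
    by (simp add: lookup_pderiv_at lp mi_size_plus_axis del: One_nat_def of_nat_Suc)
  show ?thesis
  proof (cases k)
    case 0
    \<comment> \<open>For \<open>k = 0\<close> the least part is constant, and its derivative is the
      least part of the zero function.\<close>
    then have "pderiv_at i (least_part b f) = 0" by (intro poly_mapping_eqI) (simp add: pd)
    then show ?thesis using zZ z by (metis)
  next
    case (Suc m)
    have "jet m f b = 0" using low Suc by (auto simp: jet_def)
    then obtain g where g: "g \<in> Z" "jet m g b = (\<lambda>\<nu>. if mi_size \<nu> \<le> m then cpartial i (\<lambda>t. taylor_coeff f t \<nu>) b else 0)"
      using ex_jet_eq_derivative[of b m f i] b f by (auto simp: bundle_points_def)
    have gc: "taylor_coeff g b \<nu> = of_nat (Suc (\<nu> $ i)) * taylor_coeff f b (\<nu> + axis i 1)" if "mi_size \<nu> \<le> m" for \<nu>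
      using fun_cong[OF g(2), of \<nu>] that cpartial_taylor_coeff[OF f bU] by (simp add: jet_def del: One_nat_def of_nat_Suc)
    have glow: "taylor_coeff g b \<nu> = 0" if "mi_size \<nu> < m" for \<nu>
      using gc[of \<nu>] low[of "\<nu> + axis i 1"] that Suc by (simp add: mi_size_plus_axis del: One_nat_def)
    have pd': "Poly_Mapping.lookup (pderiv_at i (least_part b f)) \<nu> = (if mi_size \<nu> = m then taylor_coeff g b \<nu> else 0)" for \<nu>
      using gc[of \<nu>] by (simp add: pd Suc del: One_nat_def of_nat_Suc)
    show ?thesis
    proof (cases "\<exists>\<nu>. mi_size \<nu> = m \<and> taylor_coeff g b \<nu> \<noteq> 0")
      case True
      then obtain \<nu>0 where \<nu>0: "mi_size \<nu>0 = m" "taylor_coeff g b \<nu>0 \<noteq> 0" by blast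
      then have "\<not> eventually (\<lambda>t. g t = 0) (nhds b)"
        using eventually_zero_iff_mpartial[OF open_U holo_Z[OF g(1)] bU] tc by auto
      from lookup_least_part[OF this \<nu>0(2,1) glow]
      have "pderiv_at i (least_part b f) = least_part b g"
        by (intro poly_mapping_eqI) (simp add: pd')
      then show ?thesis using g(1) by blast
    next
      case False
      \<comment> \<open>If \<open>g\<close> has no part of degree \<open>m\<close>, its own least
        part may have higher degree, but then the derivative is zero and the zero function serves
        instead.\<close>
      then have "pderiv_at i (least_part b f) = 0" by (intro poly_mapping_eqI) (auto simp: pd')
      then show ?thesis using zZ z by (metis)
    qed
  qed
qed

lemma bundle_points_subset_inv_points: "bundle_points U Z \<subseteq> inv_points U Z"
proof
  fix b assume b: "b \<in> bundle_points U Z"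
  have "D_invariant (least_space Z b)"
    unfolding least_space_def
  proof (rule D_invariant_span)
    fix i p assume "p \<in> least_part b ` Z"
    then show "pderiv_at i p \<in> cpoly.span (least_part b ` Z)"
      using pderiv_at_least_part[OF b] by (metis (no_types, lifting) cpoly.span_base imageE imageI)
  qed
  then show "b \<in> inv_points U Z"
    using b by (auto simp: inv_points_def bundle_points_def bundle_points_at_def)
qed

end

theorem theorem4p5:
  fixes U :: "(complex^'n) set" and Z :: "(complex^'n \<Rightarrow> complex) set"
  assumes "open U" and "connected U" and "U \<noteq> {}"
    and "Z \<subseteq> holo_fns U" and "cfun.subspace Z"
    and "\<exists>B. finite B \<and> cfun.span B = Z"
  shows "bundle_points U Z \<noteq> {} \<and> analytically_open U (bundle_points U Z) \<and>
         bundle_points U Z \<subseteq> inv_points U Z"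
proof -
  obtain B where B: "finite B" "cfun.span B = Z" using assms(6) by blast
  interpret jet_family U B Z
    using assms B by unfold_locales (auto simp: holo_fns_def)
  show ?thesis
    using nonvanishing_bundle_points[OF assms(2,3)] analytically_open_nonvanishing bundle_points_subset_inv_points
    by blast
qed

end
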